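(* Let $A,B,C\in\mathbb{H}_{11}$ be polynomials such that $AC\in\mathbb{H}_{11}$, and consider the surface in $\mathbb{R}^4=\mathbb{H}$ parametrized by $$\Phi(u,v)=A(u,v)^{-1}B(u,v)C(u,v)^{-1}.$$ (1) If the surface $\Phi$ is contained in $\mathbb{R}^3=\mathrm{Im}\,\mathbb{H}$, then it is a subset of either a Euclidean translational surface or a Darboux cyclide. (2) If the surface $\Phi$ is contained in $S^3$, then it is a subset of either a Clifford translational surface (in $S^3$) or an intersection of $S^3$ with another $3$-dimensional quadric.
   Context: $\mathbb{R}^4$ is identified with the skew field $\mathbb{H}$ of quaternions, $\mathbb{R}^3$ with the set $\mathrm{Im}\,\mathbb{H}$ of purely imaginary quaternions, and $S^3$ with the set of unit quaternions. $\mathbb{H}_{mn}\subset\mathbb{H}[u,v]$ is the set of polynomials with quaternionic coefficients of degree at most $m$ in $u$ and at most $n$ in $v$; the variables $u,v$ commute with each other and with the coefficients, and polynomials are evaluated at real $u,v$ only. A surface is an analytic surface: the image of an injective real analytic map of a planar domain (here, a domain of points $(u,v)\in\mathbb{R}^2$ where $A$ and $C$ do not vanish) into $\mathbb{R}^n$ with nondegenerate differential at each point; the map and its image are denoted by the same letter. A circle is either an ordinary circle or a straight line. A Darboux cyclide is a subset of $\mathbb{R}^3$ given by an equation $$a(x^2+y^2+z^2)^2+(x^2+y^2+z^2)(bx+cy+dz)+Q(x,y,z)=0,$$ where $a,b,c,d\in\mathbb{R}$ and $Q\in\mathbb{R}[x,y,z]$ of degree $\le 2$ do not vanish simultaneously.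 A Euclidean translational surface is a set $\{p+q: p\in\alpha, q\in\beta\}$, where $\alpha,\beta$ are two fixed circles in $\mathbb{R}^3$. A Clifford translational surface in $S^3$ is a set $\{p\cdot q: p\in\alpha,q\in\beta\}$ (quaternionic product), where $\alpha,\beta$ are two fixed circles in $S^3$. A $3$-dimensional quadric is the zero set in $\mathbb{R}^4$ of a real polynomial of degree $2$ (possibly degenerate); "another" means that the polynomial is not a multiple of the equation of $S^3$. *)

theory Defs
  imports "HOL-Analysis.Analysis" "HOL-Library.Poly_Mapping"
begin

datatype quat = Quat (qRe: real) (qI: real) (qJ: real) (qK: real)

lemma quat_eq_iff: "x = y \<longleftrightarrow> qRe x = qRe y \<and> qI x = qI y \<and> qJ x = qJ y \<and> qK x = qK y"
  by (cases x; cases y) simp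

instantiation quat :: ab_group_add
begin

definition zero_quat where "0 = Quat 0 0 0 0"
definition plus_quat where "x + y = Quat (qRe x + qRe y) (qI x + qI y) (qJ x + qJ y) (qK x + qK y)"
definition uminus_quat where "- x = Quat (- qRe x) (- qI x) (- qJ x) (- qK x)"
definition minus_quat where "x - y = Quat (qRe x - qRe y) (qI x - qI y) (qJ x - qJ y) (qK x - qK y)"

instance
  by standard
    (simp_all add: quat_eq_iff zero_quat_def plus_quat_def uminus_quat_def minus_quat_def)

end

lemma quat_add_group_sel [simp]:
  "qRe 0 = 0" "qI 0 = 0" "qJ 0 = 0" "qK 0 = 0"
  "qRe (x + y) = qRe x + qRe y" "qI (x + y) = qI x + qI y"
  "qJ (x + y) = qJ x + qJ y" "qK (x + y) = qK x + qK y"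
  "qRe (- x) = - qRe x" "qI (- x) = - qI x" "qJ (- x) = - qJ x" "qK (- x) = - qK x"
  "qRe (x - y) = qRe x - qRe y" "qI (x - y) = qI x - qI y"
  "qJ (x - y) = qJ x - qJ y" "qK (x - y) = qK x - qK y"
  by (simp_all add: zero_quat_def plus_quat_def uminus_quat_def minus_quat_def)

instantiation quat :: real_vector
begin

definition scaleR_quat where "r *\<^sub>R x = Quat (r * qRe x) (r * qI x) (r * qJ x) (r * qK x)"

instance
  by standard (simp_all add: quat_eq_iff scaleR_quat_def algebra_simps)

end

lemma quat_scaleR_sel [simp]:
  "qRe (r *\<^sub>R x) = r * qRe x" "qI (r *\<^sub>R x) = r * qI x"
  "qJ (r *\<^sub>R x) = r * qJ x" "qK (r *\<^sub>R x) = r * qK x"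
  by (simp_all add: scaleR_quat_def)

instantiation quat :: real_inner
begin

definition inner_quat where
  "x \<bullet> y = qRe x * qRe y + qI x * qI y + qJ x * qJ y + qK x * qK y"
definition norm_quat where "norm (x :: quat) = sqrt (x \<bullet> x)"
definition sgn_quat where "sgn (x :: quat) = x /\<^sub>R norm x"
definition dist_quat where "dist (x :: quat) y = norm (x - y)"
definition uniformity_quat where
  "(uniformity :: (quat \<times> quat) filter) = (INF e\<in>{0 <..}. principal {(x, y). dist x y < e})"
definition open_quat where
  "open (U :: quat set) \<longleftrightarrow> (\<forall>x\<in>U. \<forall>\<^sub>F (x', y) in uniformity. x' = x \<longrightarrow> y \<in> U)"

instance
proof
  fix x y z :: quat and r :: real
  show "sgn x = x /\<^sub>R norm x"
    by (fact sgn_quat_def)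
  show "dist x y = norm (x - y)"
    by (fact dist_quat_def)
  show "(uniformity :: (quat \<times> quat) filter) = (INF e\<in>{0 <..}. principal {(x, y). dist x y < e})"
    by (fact uniformity_quat_def)
  show "open U \<longleftrightarrow> (\<forall>x\<in>U. \<forall>\<^sub>F (x', y) in uniformity. x' = x \<longrightarrow> y \<in> U)" for U :: "quat set"
    by (fact open_quat_def)
  show "x \<bullet> y = y \<bullet> x" "(x + y) \<bullet> z = x \<bullet> z + y \<bullet> z" "r *\<^sub>R x \<bullet> y = r * (x \<bullet> y)" "0 \<le> x \<bullet> x"
    by (simp_all add: inner_quat_def algebra_simps)
  show "(x \<bullet> x = 0) = (x = 0)"
    by (auto simp: inner_quat_def quat_eq_iff add_nonneg_eq_0_iff)
  show "norm x = sqrt (x \<bullet> x)"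
    by (fact norm_quat_def)
qed

end

instantiation quat :: euclidean_space
begin

definition Basis_quat where
  "Basis = {Quat 1 0 0 0, Quat 0 1 0 0, Quat 0 0 1 0, Quat 0 0 0 1}"

instance
proof
  fix x u v :: quat
  show "(Basis :: quat set) \<noteq> {}" "finite (Basis :: quat set)"
    by (simp_all add: Basis_quat_def)
  show "(\<forall>u\<in>Basis. x \<bullet> u = 0) \<longleftrightarrow> x = 0"
    by (simp add: Basis_quat_def inner_quat_def quat_eq_iff [of x 0])
  assume "u \<in> Basis" "v \<in> Basis"
  then show "u \<bullet> v = (if u = v then 1 else 0)"
    unfolding Basis_quat_def insert_iff empty_iff by (elim disjE) (simp_all add: inner_quat_def)
qed

end

instantiation quat :: real_normed_div_algebra
begin

definition one_quat where "1 = Quat 1 0 0 0"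
definition times_quat where
  "x * y = Quat
     (qRe x * qRe y - qI x * qI y - qJ x * qJ y - qK x * qK y)
     (qRe x * qI y + qI x * qRe y + qJ x * qK y - qK x * qJ y)
     (qRe x * qJ y - qI x * qK y + qJ x * qRe y + qK x * qI y)
     (qRe x * qK y + qI x * qJ y - qJ x * qI y + qK x * qRe y)"
definition inverse_quat where
  "inverse x = Quat (qRe x) (- qI x) (- qJ x) (- qK x) /\<^sub>R (x \<bullet> x)"
definition divide_quat where "x div y = x * inverse (y :: quat)"

instance
proof
  fix x y z :: quat and r :: real
  show "x * y * z = x * (y * z)"
    unfolding quat_eq_iff times_quat_def quat.sel by (intro conjI; algebra)
  show "(x + y) * z = x * z + y * z" "x * (y + z) = x * y + x * z"
    by (simp_all add: quat_eq_iff times_quat_def algebra_simps)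
  have scale: "r *\<^sub>R x * y = r *\<^sub>R (x * y)" "x * r *\<^sub>R y = r *\<^sub>R (x * y)" for r and x y :: quat
    by (simp_all add: quat_eq_iff times_quat_def algebra_simps)
  then show "r *\<^sub>R x * y = r *\<^sub>R (x * y)" "x * r *\<^sub>R y = r *\<^sub>R (x * y)"
    by blast+
  show "1 * x = x" "x * 1 = x"
    by (simp_all add: quat_eq_iff one_quat_def times_quat_def)
  show "0 \<noteq> (1 :: quat)" "inverse 0 = (0 :: quat)"
    by (simp_all add: quat_eq_iff one_quat_def inverse_quat_def)
  show "x div y = x * inverse y"
    by (fact divide_quat_def)
  show "norm (x * y) = norm x * norm y"
    unfolding norm_quat_def real_sqrt_mult [symmetric]
    by (rule arg_cong [where f = sqrt]) (unfold inner_quat_def times_quat_def quat.sel, algebra)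
  assume "x \<noteq> 0"
  then have "x \<bullet> x \<noteq> 0"
    by simp
  moreover have "Quat (qRe x) (- qI x) (- qJ x) (- qK x) * x = (x \<bullet> x) *\<^sub>R 1"
    "x * Quat (qRe x) (- qI x) (- qJ x) (- qK x) = (x \<bullet> x) *\<^sub>R 1"
    by (simp_all add: quat_eq_iff one_quat_def times_quat_def inner_quat_def)
  ultimately show "inverse x * x = 1" "x * inverse x = 1"
    by (simp_all add: inverse_quat_def scale)
qed

end

definition ImH :: "quat set" where
  "ImH = {q. qRe q = 0}"

definition S3 :: "quat set" where
  "S3 = {q. norm q = 1}"

text \<open>
  The multiplication of \<^typ>\<open>(nat \<times> nat) \<Rightarrow>\<^sub>0 quat\<close> is convolution, so this is the
  ring \<open>\<bbbH>[u,v]\<close> in which \<open>u\<close>, \<open>v\<close> commute with each other and with all coefficients;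
  the key \<open>(i, j)\<close> stands for the monomial \<open>u\<^sup>i v\<^sup>j\<close>.
\<close>
type_synonym quat_poly = "(nat \<times> nat) \<Rightarrow>\<^sub>0 quat"

definition Hpoly :: "nat \<Rightarrow> nat \<Rightarrow> quat_poly set" where
  "Hpoly m n = {P. \<forall>(i, j) \<in> Poly_Mapping.keys P. i \<le> m \<and> j \<le> n}"

definition eval_qp :: "quat_poly \<Rightarrow> real \<times> real \<Rightarrow> quat" where
  "eval_qp P = (\<lambda>(u, v). \<Sum>(i, j) \<in> Poly_Mapping.keys P.
     (u ^ i * v ^ j) *\<^sub>R Poly_Mapping.lookup P (i, j))"

definition Phi :: "quat_poly \<Rightarrow> quat_poly \<Rightarrow> quat_poly \<Rightarrow> real \<times> real \<Rightarrow> quat" where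
  "Phi A B C w = inverse (eval_qp A w) * eval_qp B w * inverse (eval_qp C w)"

definition real_analytic2_on :: "(real \<times> real \<Rightarrow> 'a::real_normed_vector) \<Rightarrow> (real \<times> real) set \<Rightarrow> bool"
  where
  "real_analytic2_on f D \<longleftrightarrow>
     (\<forall>(a, b) \<in> D. \<exists>c :: nat \<times> nat \<Rightarrow> 'a. \<exists>r > 0. \<forall>u v. \<bar>u - a\<bar> < r \<longrightarrow> \<bar>v - b\<bar> < r \<longrightarrow>
        ((\<lambda>(i, j). ((u - a) ^ i * (v - b) ^ j) *\<^sub>R c (i, j)) has_sum f (u, v)) UNIV)"

text \<open>\<open>f\<close> restricted to the planar domain \<open>D\<close> parametrizes the analytic surface \<open>f ` D\<close>.\<close>
definition analytic_surface :: "(real \<times> real) set \<Rightarrow> (real \<times> real \<Rightarrow> 'a::real_normed_vector) \<Rightarrow> bool"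
  where
  "analytic_surface D f \<longleftrightarrow>
     open D \<and> connected D \<and> D \<noteq> {} \<and> real_analytic2_on f D \<and> inj_on f D \<and>
     (\<forall>w \<in> D. \<exists>f'. (f has_derivative f') (at w) \<and> inj f')"

definition ordinary_circle :: "'a::euclidean_space set \<Rightarrow> bool" where
  "ordinary_circle S \<longleftrightarrow>
     (\<exists>P c r. affine P \<and> aff_dim P = 2 \<and> c \<in> P \<and> r > 0 \<and> S = P \<inter> sphere c r)"

definition straight_line :: "'a::euclidean_space set \<Rightarrow> bool" where
  "straight_line S \<longleftrightarrow> affine S \<and> aff_dim S = 1"

definition is_circle :: "'a::euclidean_space set \<Rightarrow> bool" where
  "is_circle S \<longleftrightarrow> ordinary_circle S \<or> straight_line S"

definition euclidean_translational :: "quat set \<Rightarrow> bool" where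
  "euclidean_translational S \<longleftrightarrow>
     (\<exists>\<alpha> \<beta>. is_circle \<alpha> \<and> \<alpha> \<subseteq> ImH \<and> is_circle \<beta> \<and> \<beta> \<subseteq> ImH \<and>
            S = {p + q |p q. p \<in> \<alpha> \<and> q \<in> \<beta>})"

definition clifford_translational :: "quat set \<Rightarrow> bool" where
  "clifford_translational S \<longleftrightarrow>
     (\<exists>\<alpha> \<beta>. is_circle \<alpha> \<and> \<alpha> \<subseteq> S3 \<and> is_circle \<beta> \<and> \<beta> \<subseteq> S3 \<and>
            S = {p * q |p q. p \<in> \<alpha> \<and> q \<in> \<beta>})"

definition qcoord :: "quat \<Rightarrow> nat \<Rightarrow> real" where
  "qcoord q i = [qRe q, qI q, qJ q, qK q] ! i"

text \<open>
  The value at \<open>x\<close> of the real polynomial of degree at most 2 in the variables indexed by \<open>I\<close>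
  with coefficients \<open>M i j\<close> (of \<open>x\<^sub>i x\<^sub>j\<close>, for \<open>i \<le> j\<close> only), \<open>l i\<close> and \<open>e\<close>.
\<close>
definition quad_poly ::
    "nat set \<Rightarrow> (nat \<Rightarrow> nat \<Rightarrow> real) \<Rightarrow> (nat \<Rightarrow> real) \<Rightarrow> real \<Rightarrow> (nat \<Rightarrow> real) \<Rightarrow> real" where
  "quad_poly I M l e x =
     (\<Sum>i\<in>I. \<Sum>j\<in>{j\<in>I. i \<le> j}. M i j * x i * x j) + (\<Sum>i\<in>I. l i * x i) + e"

definition darboux_cyclide :: "quat set \<Rightarrow> bool" where
  "darboux_cyclide S \<longleftrightarrow>
     (\<exists>a b c d M l e.
        (a \<noteq> 0 \<or> b \<noteq> 0 \<or> c \<noteq> 0 \<or> d \<noteq> 0 \<or>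
         (\<exists>i\<in>{1..3}. \<exists>j\<in>{1..3}. i \<le> j \<and> M i j \<noteq> 0) \<or> (\<exists>i\<in>{1..3}. l i \<noteq> 0) \<or> e \<noteq> 0) \<and>
        S = {q \<in> ImH. let x = qI q; y = qJ q; z = qK q in
              a * (x\<^sup>2 + y\<^sup>2 + z\<^sup>2)\<^sup>2 + (x\<^sup>2 + y\<^sup>2 + z\<^sup>2) * (b * x + c * y + d * z)
              + quad_poly {1..3} M l e (qcoord q) = 0})"

text \<open>
  Real polynomials on \<open>\<real>\<^sup>4\<close> are identified with the functions they define, so being a multiple
  of the equation of the sphere is stated for functions.
\<close>
definition other_quadric :: "quat set \<Rightarrow> bool" where
  "other_quadric S \<longleftrightarrow>
     (\<exists>M l e.
        (\<exists>i\<in>{0..3}. \<exists>j\<in>{0..3}. i \<le> j \<and> M i j \<noteq> 0) \<and>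
        \<not> (\<exists>t. \<forall>q. quad_poly {0..3} M l e (qcoord q) = t * ((norm q)\<^sup>2 - 1)) \<and>
        S = {q. quad_poly {0..3} M l e (qcoord q) = 0})"

end

theory Submission
  imports Defs
begin

text \<open>
  Comparing degrees in \<open>AC\<close> leaves, up to exchanging the variables, \<open>A\<close> or \<open>C\<close> constant, or
  \<open>A = A(u)\<close> and \<open>C = C(v)\<close>.

  Let \<open>\<Phi> = BC\<^sup>-\<^sup>1\<close> lie in \<open>S\<^sup>3\<close>. Then \<open>|B| = |C|\<close>, so the coefficients of \<open>B\<close> and of \<open>C\<close> have the same Gram
  matrix, except that two opposite entries may differ by \<open>\<plusminus>g\<close>. If \<open>g = 0\<close>, a product of reflections
  takes \<open>C\<close> to \<open>B\<close>, so \<open>B = pCq\<close> or \<open>B = p\<cdot>qcnj C\<cdot>q\<close> with unit \<open>p\<close>, \<open>q\<close>, and a quadric through \<open>\<Phi>\<close> can be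
  written down. If \<open>g \<noteq> 0\<close>, the four vectors \<open>d\<^sub>i\<^sub>j = B\<^sub>i\<^sub>j - \<Phi>C\<^sub>i\<^sub>j\<close> are linearly dependent; their
  determinant is a quadratic function on \<open>S\<^sup>3\<close>, because each \<open>qcnj d\<^sub>i\<^sub>j\<cdot>d\<^sub>k\<^sub>l\<close> is affine there, and it does not
  vanish identically, since otherwise a torus would cover \<open>S\<^sup>3\<close>. Surfaces in \<open>Im H\<close> reduce to this by the
  Cayley transform, which turns quadrics into Darboux cyclides.

  In the remaining case \<open>(u + a)\<Phi>(v + c) = B\<close> with \<open>a\<close>, \<open>c\<close> imaginary. In \<open>S\<^sup>3\<close> the norm condition forces
  \<open>B = b(u + q)(v + p)\<close>, a Clifford translational surface, or \<open>B = b(v + p)(u + q)\<close>, which satisfies an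
  explicit quadratic equation. In \<open>Im H\<close> the surface is translational if \<open>a\<close>, \<open>c\<close> are linearly
  independent, and lies in a plane orthogonal to \<open>a\<close> otherwise.
\<close>

subsection \<open>Quaternion algebra\<close>

lemma quat_times_sel [simp]:
  "qRe (x * y) = qRe x * qRe y - qI x * qI y - qJ x * qJ y - qK x * qK y"
  "qI (x * y) = qRe x * qI y + qI x * qRe y + qJ x * qK y - qK x * qJ y"
  "qJ (x * y) = qRe x * qJ y - qI x * qK y + qJ x * qRe y + qK x * qI y"
  "qK (x * y) = qRe x * qK y + qI x * qJ y - qJ x * qI y + qK x * qRe y"
  by (simp_all add: times_quat_def)

lemma quat_one_sel [simp]: "qRe 1 = 1" "qI 1 = 0" "qJ 1 = 0" "qK 1 = 0"
  by (simp_all add: one_quat_def)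

lemma quat_of_real_sel [simp]:
  "qRe (of_real r) = r" "qI (of_real r) = 0" "qJ (of_real r) = 0" "qK (of_real r) = 0"
  by (simp_all add: of_real_def)

definition qcnj :: "quat \<Rightarrow> quat" where
  "qcnj x = Quat (qRe x) (- qI x) (- qJ x) (- qK x)"

lemma qcnj_sel [simp]:
  "qRe (qcnj x) = qRe x" "qI (qcnj x) = - qI x" "qJ (qcnj x) = - qJ x" "qK (qcnj x) = - qK x"
  by (simp_all add: qcnj_def)

lemma qcnj_simps [simp]:
  "qcnj (qcnj x) = x" "qcnj (x + y) = qcnj x + qcnj y" "qcnj (x - y) = qcnj x - qcnj y"
  "qcnj (r *\<^sub>R x) = r *\<^sub>R qcnj x" "qcnj (x * y) = qcnj y * qcnj x" "qcnj 1 = 1" "qcnj 0 = 0"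
  "qcnj (- x) = - qcnj x"
  by (simp_all add: quat_eq_iff algebra_simps)

lemma norm_quat_sq: "(norm (x::quat))\<^sup>2 = (qRe x)\<^sup>2 + (qI x)\<^sup>2 + (qJ x)\<^sup>2 + (qK x)\<^sup>2"
  unfolding power2_norm_eq_inner inner_quat_def by (simp add: power2_eq_square)

lemma norm_qcnj [simp]: "norm (qcnj x) = norm x"
  by (simp add: norm_quat_def inner_quat_def)

lemma qcnj_eq_0_iff [simp]: "qcnj x = 0 \<longleftrightarrow> x = 0"
  by (simp add: quat_eq_iff)

lemma mult_qcnj: "x * qcnj x = (norm x)\<^sup>2 *\<^sub>R 1" "qcnj x * x = (norm x)\<^sup>2 *\<^sub>R 1"
  unfolding norm_quat_sq by (simp_all add: quat_eq_iff power2_eq_square)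

lemma inverse_quat_qcnj: "inverse x = qcnj x /\<^sub>R (norm x)\<^sup>2"
  by (simp add: inverse_quat_def qcnj_def power2_norm_eq_inner)

lemma inner_quat_Re: "x \<bullet> y = qRe (qcnj x * y)"
  by (simp add: inner_quat_def)

lemma inner_mult_left: "(p * x) \<bullet> (p * y) = (norm p)\<^sup>2 * (x \<bullet> y)" for p x y :: quat
  unfolding norm_quat_sq inner_quat_def quat_times_sel by algebra

lemma inner_mult_right: "(x * p) \<bullet> (y * p) = (norm p)\<^sup>2 * (x \<bullet> y)" for p x y :: quat
  unfolding norm_quat_sq inner_quat_def quat_times_sel by algebra

lemma inner_qcnj: "qcnj x \<bullet> qcnj y = x \<bullet> y"
  by (simp add: inner_quat_def)

lemma qRe_mult_commute: "qRe (x * y) = qRe (y * x)"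
  by simp

lemma qcnj_unit: "norm p = 1 \<Longrightarrow> qcnj p * p = 1" "norm p = 1 \<Longrightarrow> p * qcnj p = 1"
  by (simp_all add: mult_qcnj)

lemma qcnj_unit_left: "norm p = 1 \<Longrightarrow> qcnj p * (p * x) = x" "norm p = 1 \<Longrightarrow> p * (qcnj p * x) = x"
  by (simp_all add: qcnj_unit mult.assoc [symmetric])

lemma quat_inverse_cancel:
  fixes k x :: quat assumes "k \<noteq> 0"
  shows "inverse k * (k * x) = x" "x * k * inverse k = x"
  using assms by (simp_all add: mult.assoc [symmetric]) (simp add: mult.assoc)

text \<open>The vector \<open>b\<cdot>qcnj c\<cdot>d - d\<cdot>qcnj c\<cdot>b\<close> is twice the cross product of \<open>b\<close>, \<open>c\<close>, \<open>d\<close> in \<open>\<real>\<^sup>4\<close>.\<close>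

lemma inner_cross_eq_0:
  fixes b c d :: quat
  defines "X \<equiv> b * qcnj c * d - d * qcnj c * b"
  shows "b \<bullet> X = 0" "c \<bullet> X = 0" "d \<bullet> X = 0"
  unfolding X_def inner_quat_def quat_times_sel quat_add_group_sel qcnj_sel by algebra+

subsection \<open>Quadratic functions on the quaternions\<close>

text \<open>Polynomials of degree at most 2, taken as functions so that closure rules can replace
  bookkeeping of coefficients. Lower degree is allowed; it is raised to 2 only at the end.\<close>

definition quadfun :: "(quat \<Rightarrow> real) \<Rightarrow> bool" where
  "quadfun f \<longleftrightarrow> (\<exists>M l e. \<forall>q. f q = quad_poly {0..3} M l e (qcoord q))"

lemma quad_poly_explicit:
  "quad_poly {0..3} M l e (qcoord q) =
     M 0 0 * qRe q * qRe q + M 0 1 * qRe q * qI q + M 0 2 * qRe q * qJ q + M 0 3 * qRe q * qK q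
     + M 1 1 * qI q * qI q + M 1 2 * qI q * qJ q + M 1 3 * qI q * qK q
     + M 2 2 * qJ q * qJ q + M 2 3 * qJ q * qK q + M 3 3 * qK q * qK q
     + l 0 * qRe q + l 1 * qI q + l 2 * qJ q + l 3 * qK q + e"
proof -
  have s: "{0..3} = {0, 1, 2, 3::nat}" by auto
  have t: "{j \<in> {0, 1, 2, 3::nat}. 0 \<le> j} = {0, 1, 2, 3}"
    "{j \<in> {0, 1, 2, 3::nat}. 1 \<le> j} = {1, 2, 3}"
    "{j \<in> {0, 1, 2, 3::nat}. 2 \<le> j} = {2, 3}"
    "{j \<in> {0, 1, 2, 3::nat}. 3 \<le> j} = {3}" by auto
  show ?thesis
    unfolding quad_poly_def s
    by (simp add: t [simplified]) (simp add: qcoord_def eval_nat_numeral)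
qed

lemma quad_poly_explicit_Im:
  "quad_poly {1..3} M l e (qcoord q) =
     M 1 1 * qI q * qI q + M 1 2 * qI q * qJ q + M 1 3 * qI q * qK q
     + M 2 2 * qJ q * qJ q + M 2 3 * qJ q * qK q + M 3 3 * qK q * qK q
     + l 1 * qI q + l 2 * qJ q + l 3 * qK q + e"
proof -
  have s: "{1..3} = {1, 2, 3::nat}" by auto
  have t: "{j \<in> {1, 2, 3::nat}. 1 \<le> j} = {1, 2, 3}"
    "{j \<in> {1, 2, 3::nat}. 2 \<le> j} = {2, 3}"
    "{j \<in> {1, 2, 3::nat}. 3 \<le> j} = {3}" by auto
  show ?thesis
    unfolding quad_poly_def s
    by (simp add: t [simplified]) (simp add: qcoord_def eval_nat_numeral)
qed

lemma quadfun_add: assumes "quadfun f" "quadfun g" shows "quadfun (\<lambda>q. f q + g q)"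
proof -
  obtain M l e M' l' e' where *: "\<forall>q. f q = quad_poly {0..3} M l e (qcoord q)"
    "\<forall>q. g q = quad_poly {0..3} M' l' e' (qcoord q)"
    using assms unfolding quadfun_def by blast
  have "\<forall>q. f q + g q = quad_poly {0..3} (\<lambda>i j. M i j + M' i j) (\<lambda>i. l i + l' i) (e + e') (qcoord q)"
    unfolding * [rule_format] quad_poly_explicit by (simp add: algebra_simps)
  then show ?thesis unfolding quadfun_def by blast
qed

lemma quadfun_cmult: assumes "quadfun f" shows "quadfun (\<lambda>q. r * f q)"
proof -
  obtain M l e where *: "\<forall>q. f q = quad_poly {0..3} M l e (qcoord q)"
    using assms unfolding quadfun_def by blast
  have "\<forall>q. r * f q = quad_poly {0..3} (\<lambda>i j. r * M i j) (\<lambda>i. r * l i) (r * e) (qcoord q)"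
    unfolding * [rule_format] quad_poly_explicit by (simp add: algebra_simps)
  then show ?thesis unfolding quadfun_def by blast
qed

lemma quadfun_diff: "quadfun f \<Longrightarrow> quadfun g \<Longrightarrow> quadfun (\<lambda>q. f q - g q)"
  using quadfun_add [OF _ quadfun_cmult [of g "-1"]] by simp

section \<open>Affine functions and maps, the factors of quadratic functions\<close>

definition affine_fun :: "(quat \<Rightarrow> real) \<Rightarrow> bool" where
  "affine_fun f \<longleftrightarrow> (\<exists>n e. \<forall>q. f q = n \<bullet> q + e)"

lemma affine_fun_const: "affine_fun (\<lambda>q. e)"
  unfolding affine_fun_def by (rule exI [of _ 0]) simp

lemma affine_fun_inner: "affine_fun (\<lambda>q. n \<bullet> q)"
  unfolding affine_fun_def by (rule exI [of _ n], rule exI [of _ 0]) simp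

lemma affine_fun_add: assumes "affine_fun f" "affine_fun g" shows "affine_fun (\<lambda>q. f q + g q)"
proof -
  obtain n e n' e' where *: "\<forall>q. f q = n \<bullet> q + e" "\<forall>q. g q = n' \<bullet> q + e'"
    using assms unfolding affine_fun_def by blast
  have "\<forall>q. f q + g q = (n + n') \<bullet> q + (e + e')"
    unfolding * [rule_format] by (simp add: inner_add_left)
  then show ?thesis unfolding affine_fun_def by blast
qed

lemma affine_fun_cmult: assumes "affine_fun f" shows "affine_fun (\<lambda>q. r * f q)"
proof -
  obtain n e where *: "\<forall>q. f q = n \<bullet> q + e"
    using assms unfolding affine_fun_def by blast
  have "\<forall>q. r * f q = (r *\<^sub>R n) \<bullet> q + r * e"
    unfolding * [rule_format] by (simp add: algebra_simps)
  then show ?thesis unfolding affine_fun_def by blast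
qed

lemma affine_fun_diff: "affine_fun f \<Longrightarrow> affine_fun g \<Longrightarrow> affine_fun (\<lambda>q. f q - g q)"
  using affine_fun_add [OF _ affine_fun_cmult [of g "-1"]] by simp

lemma quadfun_mult: assumes "affine_fun f" "affine_fun g" shows "quadfun (\<lambda>q. f q * g q)"
proof -
  obtain n e n' e' where *: "\<forall>q. f q = n \<bullet> q + e" "\<forall>q. g q = n' \<bullet> q + e'"
    using assms unfolding affine_fun_def by blast
  \<comment> \<open>\<open>quad_poly\<close> lists each mixed monomial once, with
    \<open>i \<le> j\<close>, so both cross products go into a single coefficient.\<close>
  have "\<forall>q. f q * g q = quad_poly {0..3}
     (\<lambda>i j. if i = j then qcoord n i * qcoord n' i else qcoord n i * qcoord n' j + qcoord n j * qcoord n' i)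
     (\<lambda>i. e' * qcoord n i + e * qcoord n' i) (e * e') (qcoord q)"
    unfolding * [rule_format] quad_poly_explicit inner_quat_def
    by (simp add: qcoord_def eval_nat_numeral algebra_simps)
  then show ?thesis unfolding quadfun_def by blast
qed

lemma quadfun_affine: "affine_fun f \<Longrightarrow> quadfun f"
  using quadfun_mult [OF affine_fun_const [of 1]] by simp

text \<open>Tested against every \<open>n\<close>, so that one-sided multiplication by a constant
  can be moved onto \<open>n\<close> by taking adjoints.\<close>

definition affine_map :: "(quat \<Rightarrow> quat) \<Rightarrow> bool" where
  "affine_map P \<longleftrightarrow> (\<forall>n. affine_fun (\<lambda>q. n \<bullet> P q))"

lemma affine_map_intros:
  "affine_map (\<lambda>q. k)" "affine_map (\<lambda>q. q)" "affine_map qcnj"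
  "affine_map P \<Longrightarrow> affine_map Q \<Longrightarrow> affine_map (\<lambda>q. P q + Q q)"
  "affine_map P \<Longrightarrow> affine_map Q \<Longrightarrow> affine_map (\<lambda>q. P q - Q q)"
  "affine_map P \<Longrightarrow> affine_map (\<lambda>q. k * P q)"
  "affine_map P \<Longrightarrow> affine_map (\<lambda>q. P q * k)"
proof -
  have [simp]: "n \<bullet> qcnj q = qcnj n \<bullet> q" for n q by (simp add: inner_quat_def)
  have l: "n \<bullet> (k * q) = (qcnj k * n) \<bullet> q" for n k q
    by (simp add: inner_quat_def algebra_simps)
  have r: "n \<bullet> (q * k) = (n * qcnj k) \<bullet> q" for n k q
    by (simp add: inner_quat_def algebra_simps)
  show "affine_map (\<lambda>q. k)" "affine_map (\<lambda>q. q)" "affine_map qcnj"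
    by (simp_all add: affine_map_def affine_fun_const affine_fun_inner)
  show "affine_map P \<Longrightarrow> affine_map Q \<Longrightarrow> affine_map (\<lambda>q. P q + Q q)"
    "affine_map P \<Longrightarrow> affine_map Q \<Longrightarrow> affine_map (\<lambda>q. P q - Q q)"
    by (simp_all add: affine_map_def inner_add_right inner_diff_right affine_fun_add affine_fun_diff)
  show "affine_map P \<Longrightarrow> affine_map (\<lambda>q. k * P q)" "affine_map P \<Longrightarrow> affine_map (\<lambda>q. P q * k)"
    unfolding affine_map_def by (subst l, simp) (subst r, simp)
qed

lemma affine_map_inner: "affine_map P \<Longrightarrow> affine_fun (\<lambda>q. n \<bullet> P q)"
  by (simp add: affine_map_def)

lemma affine_map_sel:
  assumes "affine_map P"
  shows "affine_fun (\<lambda>q. qRe (P q))" "affine_fun (\<lambda>q. qI (P q))"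
    "affine_fun (\<lambda>q. qJ (P q))" "affine_fun (\<lambda>q. qK (P q))"
proof -
  have "affine_fun (\<lambda>q. Quat 1 0 0 0 \<bullet> P q)" "affine_fun (\<lambda>q. Quat 0 1 0 0 \<bullet> P q)"
    "affine_fun (\<lambda>q. Quat 0 0 1 0 \<bullet> P q)" "affine_fun (\<lambda>q. Quat 0 0 0 1 \<bullet> P q)"
    using assms unfolding affine_map_def by blast+
  then show "affine_fun (\<lambda>q. qRe (P q))" "affine_fun (\<lambda>q. qI (P q))"
    "affine_fun (\<lambda>q. qJ (P q))" "affine_fun (\<lambda>q. qK (P q))"
    by (simp_all add: inner_quat_def)
qed

lemma quadfun_Re_mult: "affine_map P \<Longrightarrow> affine_map Q \<Longrightarrow> quadfun (\<lambda>q. qRe (P q * Q q))"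
  unfolding quat_times_sel by (intro quadfun_diff quadfun_mult affine_map_sel)

lemma quadfun_inner: "affine_map P \<Longrightarrow> affine_map Q \<Longrightarrow> quadfun (\<lambda>q. P q \<bullet> Q q)"
  unfolding inner_quat_def by (intro quadfun_add quadfun_mult affine_map_sel)

lemma quadfun_compose_affine:
  assumes "quadfun f" and P: "affine_map P"
  shows "quadfun (\<lambda>q. f (P q))"
proof -
  obtain M l e where *: "\<forall>q. f q = quad_poly {0..3} M l e (qcoord q)"
    using assms unfolding quadfun_def by blast
  show ?thesis
    unfolding * [rule_format] quad_poly_explicit
    by (intro quadfun_add quadfun_mult quadfun_cmult affine_fun_cmult quadfun_affine affine_map_sel
      affine_fun_const P)
qed

text \<open>A nonzero value on \<open>S3\<close> rules out multiples of the equation of the sphere.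
  Degree exactly 2 need not be tracked, since a multiple of that equation can be added without
  changing the values on \<open>S3\<close>.\<close>

definition on_quadric :: "quat set \<Rightarrow> bool" where
  "on_quadric X \<longleftrightarrow> (\<exists>f. quadfun f \<and> (\<exists>y\<in>S3. f y \<noteq> 0) \<and> (\<forall>y\<in>X. f y = 0))"

lemma on_quadric_mono: "on_quadric Y \<Longrightarrow> X \<subseteq> Y \<Longrightarrow> on_quadric X"
  unfolding on_quadric_def by blast

lemma on_quadric_imp_other_quadric:
  assumes "on_quadric X" "X \<subseteq> S3"
  shows "\<exists>Y. other_quadric Y \<and> X \<subseteq> S3 \<inter> Y"
proof -
  obtain M l e y where f: "quad_poly {0..3} M l e (qcoord y) \<noteq> 0" "y \<in> S3"
    "\<forall>y\<in>X. quad_poly {0..3} M l e (qcoord y) = 0"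
    using assms unfolding on_quadric_def quadfun_def by metis
  define sphere where "sphere t = quad_poly {0..3} (\<lambda>i j. M i j + (if i = j then t else 0)) l (e - t)" for t
  have sphere: "sphere t (qcoord q) = quad_poly {0..3} M l e (qcoord q) + t * ((norm q)\<^sup>2 - 1)" for t q
    unfolding sphere_def quad_poly_explicit norm_quat_sq
    by (simp add: algebra_simps power2_eq_square)
  \<comment> \<open>Adding a multiple of the equation of the sphere makes the degree equal to 2.\<close>
  obtain t where t: "M 0 0 + t \<noteq> 0" by (metis add.right_neutral add_left_cancel zero_neq_one)
  have "other_quadric {q. sphere t (qcoord q) = 0}"
    unfolding other_quadric_def
  proof (intro exI conjI)
    show "\<exists>i\<in>{0..3}. \<exists>j\<in>{0..3}. i \<le> j \<and> M i j + (if i = j then t else 0) \<noteq> 0"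
      using t by (intro bexI [of _ 0]) auto
    \<comment> \<open>At \<open>y\<close> the equation of the sphere vanishes, while
      \<open>sphere t\<close> keeps the nonzero value of the original polynomial.\<close>
    show "\<not> (\<exists>ta. \<forall>q. quad_poly {0..3} (\<lambda>i j. M i j + (if i = j then t else 0)) l (e - t) (qcoord q)
        = ta * ((norm q)\<^sup>2 - 1))"
      using sphere [of t y] f(1,2) unfolding sphere_def [symmetric] S3_def by force
  qed (simp add: sphere_def)
  moreover have "X \<subseteq> S3 \<inter> {q. sphere t (qcoord q) = 0}"
    using f(3) assms(2) by (auto simp: sphere S3_def subset_iff)
  ultimately show ?thesis by blast
qed

section \<open>The Cayley transform, which is the inverse stereographic projection of
  \<open>ImH\<close> from -1\<close>

definition cayley :: "quat \<Rightarrow> quat" where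
  "cayley x = (1 + x) * inverse (1 - x)"

lemma cayley_eq:
  assumes "x \<in> ImH"
  shows "cayley x = ((1 - (norm x)\<^sup>2) *\<^sub>R 1 + 2 *\<^sub>R x) /\<^sub>R (1 + (norm x)\<^sup>2)"
proof -
  have x: "qRe x = 0" using assms by (simp add: ImH_def)
  have n: "(norm (1 - x))\<^sup>2 = 1 + (norm x)\<^sup>2" by (simp add: norm_quat_sq x)
  have "(1 + x) * qcnj (1 - x) = (1 - (norm x)\<^sup>2) *\<^sub>R 1 + 2 *\<^sub>R x"
    unfolding norm_quat_sq by (simp add: quat_eq_iff x power2_eq_square algebra_simps)
  then show ?thesis
    unfolding cayley_def inverse_quat_qcnj n by (simp del: qcnj_simps)
qed

lemma cayley_in_S3: assumes "x \<in> ImH" shows "cayley x \<in> S3"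
proof -
  have "norm (1 + x) = norm (1 - x)"
    using assms by (simp add: norm_quat_def inner_quat_def ImH_def)
  moreover have "1 - x \<noteq> 0" using assms by (auto simp: ImH_def quat_eq_iff)
  ultimately show ?thesis
    by (simp add: S3_def cayley_def norm_mult norm_inverse)
qed

text \<open>
  Multiplying by \<open>(1 + |x|\<^sup>2)\<^sup>2\<close> turns a quadratic equation for \<open>cayley x\<close> into the equation
  of a Darboux cyclide for \<open>x\<close>.
\<close>

lemma cayley_on_quadric_imp_darboux:
  assumes "on_quadric (cayley ` X)" "X \<subseteq> ImH"
  shows "\<exists>S. darboux_cyclide S \<and> X \<subseteq> S"
proof -
  obtain M l e y where f: "quad_poly {0..3} M l e (qcoord y) \<noteq> 0" "y \<in> S3"
    "\<And>x. x \<in> X \<Longrightarrow> quad_poly {0..3} M l e (qcoord (cayley x)) = 0"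
    using assms unfolding on_quadric_def quadfun_def by (metis image_eqI)
  \<comment> \<open>Coefficients after substituting \<open>cayley x\<close> and multiplying by
    \<open>(1 + n)\<^sup>2\<close>, where n is the square of the norm of \<open>x\<close>. The part
    linear in n alone is a multiple of the sum of the squared coordinates, hence the diagonal
    correction in \<open>M'\<close>.\<close>
  define a where "a = M 0 0 - l 0 + e"
  define b where "b k = 2 * l k - 2 * M 0 k" for k
  define M' where "M' i j = 4 * M i j + (if i = j then 2 * e - 2 * M 0 0 else 0)" for i j
  define l' where "l' k = 2 * l k + 2 * M 0 k" for k
  define e' where "e' = M 0 0 + l 0 + e"
  define S where "S = {q \<in> ImH. let x = qI q; y = qJ q; z = qK q in
              a * (x\<^sup>2 + y\<^sup>2 + z\<^sup>2)\<^sup>2 + (x\<^sup>2 + y\<^sup>2 + z\<^sup>2) * (b 1 * x + b 2 * y + b 3 * z)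
              + quad_poly {1..3} M' l' e' (qcoord q) = 0}"
  have "a \<noteq> 0 \<or> b 1 \<noteq> 0 \<or> b 2 \<noteq> 0 \<or> b 3 \<noteq> 0 \<or>
         (\<exists>i\<in>{1..3}. \<exists>j\<in>{1..3}. i \<le> j \<and> M' i j \<noteq> 0) \<or> (\<exists>i\<in>{1..3}. l' i \<noteq> 0) \<or> e' \<noteq> 0"
  proof (rule ccontr)
    assume "\<not> ?thesis"
    then have z: "a = 0" "b 1 = 0" "b 2 = 0" "b 3 = 0" "l' 1 = 0" "l' 2 = 0" "l' 3 = 0" "e' = 0"
      "M' 1 1 = 0" "M' 1 2 = 0" "M' 1 3 = 0" "M' 2 2 = 0" "M' 2 3 = 0" "M' 3 3 = 0"
      by auto
    \<comment> \<open>If the cyclide equation were trivial, the given polynomial would be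
      \<open>M 0 0\<close> times the equation of the sphere, contradicting its nonzero value at
      \<open>y\<close>.\<close>
    have c: "l 0 = 0" "e = - M 0 0" "l 1 = 0" "l 2 = 0" "l 3 = 0" "M 0 1 = 0" "M 0 2 = 0" "M 0 3 = 0"
      "M 1 2 = 0" "M 1 3 = 0" "M 2 3 = 0" "M 1 1 = M 0 0" "M 2 2 = M 0 0" "M 3 3 = M 0 0"
      using z unfolding a_def b_def M'_def l'_def e'_def by simp_all
    have "quad_poly {0..3} M l e (qcoord y) = M 0 0 * ((norm y)\<^sup>2 - 1)"
      unfolding quad_poly_explicit c norm_quat_sq by (simp add: algebra_simps power2_eq_square)
    with f(1,2) show False by (simp add: S3_def)
  qed
  then have "darboux_cyclide S"
    unfolding darboux_cyclide_def S_def by blast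
  moreover have "x \<in> S" if "x \<in> X" for x
  proof -
    have x: "x \<in> ImH" "qRe x = 0" using that assms(2) by (auto simp: ImH_def)
    define n where "n = (norm x)\<^sup>2"
    have n: "n = (qI x)\<^sup>2 + (qJ x)\<^sup>2 + (qK x)\<^sup>2" by (simp add: n_def norm_quat_sq x)
    have n1: "1 + n \<noteq> 0" using zero_le_power2 [of "norm x"] unfolding n_def by linarith
    have sel: "qRe (cayley x) = (1 - n) / (1 + n)" "qI (cayley x) = 2 * qI x / (1 + n)"
      "qJ (cayley x) = 2 * qJ x / (1 + n)" "qK (cayley x) = 2 * qK x / (1 + n)"
      unfolding cayley_eq [OF x(1)] n_def [symmetric] by (simp_all add: x divide_inverse)
    have "0 = (1 + n)\<^sup>2 * quad_poly {0..3} M l e (qcoord (cayley x))"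
      using f(3) [OF that] by simp
    also have "\<dots> = M 0 0 * (1-n) * (1-n) + M 0 1 * (1-n) * (2 * qI x) + M 0 2 * (1-n) * (2 * qJ x)
       + M 0 3 * (1-n) * (2 * qK x)
     + M 1 1 * (2 * qI x) * (2 * qI x) + M 1 2 * (2 * qI x) * (2 * qJ x) + M 1 3 * (2 * qI x) * (2 * qK x)
     + M 2 2 * (2 * qJ x) * (2 * qJ x) + M 2 3 * (2 * qJ x) * (2 * qK x) + M 3 3 * (2 * qK x) * (2 * qK x)
     + (1 + n) * (l 0 * (1-n) + l 1 * (2 * qI x) + l 2 * (2 * qJ x) + l 3 * (2 * qK x)) + (1 + n) * (1 + n) * e"
      unfolding quad_poly_explicit sel using n1
      by (simp add: divide_simps) (simp add: algebra_simps power2_eq_square)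
    also have "\<dots> = a * n\<^sup>2 + n * (b 1 * qI x + b 2 * qJ x + b 3 * qK x)
              + quad_poly {1..3} M' l' e' (qcoord x)"
      unfolding quad_poly_explicit_Im a_def b_def M'_def l'_def e'_def n if_True simp_thms
      by (simp add: algebra_simps power2_eq_square)
    finally show ?thesis unfolding S_def Let_def n using x(1) by simp
  qed
  ultimately show ?thesis by blast
qed

subsection \<open>Polynomial identities on a grid\<close>

text \<open>A product of two infinite sets of parameter values is all that comparing coefficients
  needs. The parameters are functions \<open>s\<close>, \<open>t\<close> of the point, so that they
  can be exchanged or shifted without changing \<open>D\<close>.\<close>

definition param_grid :: "('i \<Rightarrow> real) \<Rightarrow> ('i \<Rightarrow> real) \<Rightarrow> 'i set \<Rightarrow> bool" where
  "param_grid s t D \<longleftrightarrow>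
     (\<exists>U V. infinite U \<and> infinite V \<and> (\<forall>u\<in>U. \<forall>v\<in>V. \<exists>w\<in>D. s w = u \<and> t w = v))"

lemma quadratic_coeffs_zero:
  fixes r0 r1 r2 :: real
  assumes "infinite U" "\<And>u. u \<in> U \<Longrightarrow> r0 + r1 * u + r2 * u\<^sup>2 = 0"
  shows "r0 = 0 \<and> r1 = 0 \<and> r2 = 0"
proof -
  have "U \<subseteq> {u. poly [:r0, r1, r2:] u = 0}"
    using assms(2) by (auto simp: algebra_simps power2_eq_square)
  then have "[:r0, r1, r2:] = 0"
    using poly_roots_finite [of "[:r0, r1, r2:]"] assms(1) finite_subset by blast
  then show ?thesis by simp
qed

text \<open>For a fixed value of \<open>s\<close> the left side is a quadratic polynomial in
  \<open>t\<close> with infinitely many roots; its coefficients are in turn quadratic polynomials in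
  \<open>s\<close> with infinitely many roots.\<close>

lemma grid_coeffs_zero:
  assumes "param_grid s t D"
    and "\<And>w. w \<in> D \<Longrightarrow> (r00 + r10 * s w + r20 * (s w)\<^sup>2)
      + (r01 + r11 * s w + r21 * (s w)\<^sup>2) * t w + (r02 + r12 * s w + r22 * (s w)\<^sup>2) * (t w)\<^sup>2 = 0"
  shows "r00 = 0" "r10 = 0" "r20 = 0" "r01 = 0" "r11 = 0" "r21 = 0" "r02 = 0" "r12 = 0" "r22 = 0"
proof -
  obtain U V where U: "infinite U" and V: "infinite V"
    and UV: "\<And>u v. u \<in> U \<Longrightarrow> v \<in> V \<Longrightarrow> \<exists>w\<in>D. s w = u \<and> t w = v"
    using assms(1) unfolding param_grid_def by blast
  have "r00 + r10 * u + r20 * u\<^sup>2 = 0 \<and> r01 + r11 * u + r21 * u\<^sup>2 = 0 \<and> r02 + r12 * u + r22 * u\<^sup>2 = 0"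
    if "u \<in> U" for u
    by (rule quadratic_coeffs_zero [OF V]) (use UV [OF that] assms(2) in blast)
  then have "r00 = 0 \<and> r10 = 0 \<and> r20 = 0" "r01 = 0 \<and> r11 = 0 \<and> r21 = 0" "r02 = 0 \<and> r12 = 0 \<and> r22 = 0"
    using quadratic_coeffs_zero [OF U] by blast+
  then show "r00 = 0" "r10 = 0" "r20 = 0" "r01 = 0" "r11 = 0" "r21 = 0" "r02 = 0" "r12 = 0" "r22 = 0"
    by blast+
qed

section \<open>Values of polynomials of degree at most 1 in each variable\<close>

definition bil :: "quat \<Rightarrow> quat \<Rightarrow> quat \<Rightarrow> quat \<Rightarrow> real \<Rightarrow> real \<Rightarrow> quat" where
  "bil a b c d u v = a + u *\<^sub>R b + v *\<^sub>R c + (u * v) *\<^sub>R d"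

lemma bil_mult: "k * bil a b c d u v = bil (k * a) (k * b) (k * c) (k * d) u v"
  "bil a b c d u v * k = bil (a * k) (b * k) (c * k) (d * k) u v"
  by (simp_all add: bil_def algebra_simps)

lemma bil_qcnj: "qcnj (bil a b c d u v) = bil (qcnj a) (qcnj b) (qcnj c) (qcnj d) u v"
  by (simp add: bil_def)

lemma bil_add: "bil a b c d u v + bil a' b' c' d' u v = bil (a + a') (b + b') (c + c') (d + d') u v"
  by (simp add: bil_def algebra_simps)

lemma bil_diff: "bil a b c d u v - bil a' b' c' d' u v = bil (a - a') (b - b') (c - c') (d - d') u v"
  by (simp add: bil_def algebra_simps)

text \<open>All inner products of the coefficients can be read off, with one exception: the monomial
  \<open>u * v\<close> collects both \<open>a \<bullet> d\<close> and \<open>b \<bullet> c\<close>,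
  so only their sum is determined.\<close>

lemma norm_bil:
  "(norm (bil a b c d u v))\<^sup>2 = ((norm a)\<^sup>2 + 2 * (a \<bullet> b) * u + (norm b)\<^sup>2 * u\<^sup>2)
     + (2 * (a \<bullet> c) + 2 * (a \<bullet> d + b \<bullet> c) * u + 2 * (b \<bullet> d) * u\<^sup>2) * v
     + ((norm c)\<^sup>2 + 2 * (c \<bullet> d) * u + (norm d)\<^sup>2 * u\<^sup>2) * v\<^sup>2"
  unfolding power2_norm_eq_inner bil_def
  by (simp add: inner_add_left inner_add_right inner_commute power2_eq_square algebra_simps)

subsection \<open>Isometries from equal Gram matrices\<close>

text \<open>The classical quaternionic form of the orthogonal maps of four-space, orientation
  preserving and orientation reversing.\<close>

definition quat_isometry :: "(quat \<Rightarrow> quat) \<Rightarrow> bool" where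
  "quat_isometry T \<longleftrightarrow> (\<exists>p q. norm p = 1 \<and> norm q = 1 \<and>
     (T = (\<lambda>x. p * x * q) \<or> T = (\<lambda>x. p * qcnj x * q)))"

lemma quat_isometry_inner: assumes "quat_isometry T" shows "T x \<bullet> T y = x \<bullet> y"
  using assms unfolding quat_isometry_def
  by (auto simp: inner_mult_left inner_mult_right inner_qcnj)

lemma reflection_eq:
  fixes v :: quat assumes "v \<noteq> 0"
  shows "x - (2 * (x \<bullet> v) / (v \<bullet> v)) *\<^sub>R v = (- v /\<^sub>R norm v) * qcnj x * (v /\<^sub>R norm v)"
proof -
  have "v \<bullet> v \<noteq> 0" using assms by simp
  moreover have "(v \<bullet> v) *\<^sub>R x - (2 * (x \<bullet> v)) *\<^sub>R v = - v * qcnj x * v"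
    unfolding quat_eq_iff inner_quat_def by (simp; intro conjI; algebra)
  ultimately have "x - (2 * (x \<bullet> v) / (v \<bullet> v)) *\<^sub>R v = (- v * qcnj x * v) /\<^sub>R (v \<bullet> v)"
    by (metis (no_types, lifting) scaleR_diff_right divideR_right scaleR_scaleR divide_inverse_commute)
  then show ?thesis
    by (simp add: power2_norm_eq_inner [symmetric] power2_eq_square)
qed

text \<open>A reflection has the form \<open>- n * qcnj x * n\<close> with \<open>n\<close> a unit,
  so composing with it exchanges the two shapes of an isometry.\<close>

lemma quat_isometry_reflect:
  fixes v :: quat assumes "quat_isometry T" "v \<noteq> 0"
  shows "quat_isometry (\<lambda>x. T x - (2 * (T x \<bullet> v) / (v \<bullet> v)) *\<^sub>R v)"
proof -
  obtain p q where pq: "norm p = 1" "norm q = 1"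
    "T = (\<lambda>x. p * x * q) \<or> T = (\<lambda>x. p * qcnj x * q)"
    using assms(1) unfolding quat_isometry_def by blast
  define n where "n = v /\<^sub>R norm v"
  have n: "norm n = 1" using assms(2) by (simp add: n_def)
  have *: "(\<lambda>x. T x - (2 * (T x \<bullet> v) / (v \<bullet> v)) *\<^sub>R v) = (\<lambda>x. - n * qcnj (T x) * n)"
    by (simp add: reflection_eq [OF assms(2)] n_def)
  have "norm (- n * qcnj q) = 1" "norm (qcnj p * n) = 1" using n pq by (simp_all add: norm_mult)
  moreover from pq(3) have "(\<lambda>x. - n * qcnj (T x) * n) = (\<lambda>x. (- n * qcnj q) * qcnj x * (qcnj p * n)) \<or>
    (\<lambda>x. - n * qcnj (T x) * n) = (\<lambda>x. (- n * qcnj q) * x * (qcnj p * n))"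
    by (auto simp: mult.assoc)
  ultimately show ?thesis unfolding * quat_isometry_def by blast
qed

text \<open>Induction on \<open>n\<close>: an isometry that is right on the earlier vectors is
  corrected by the reflection along \<open>v = B n - T (C n)\<close>. Equality of the Gram matrices
  makes \<open>v\<close> orthogonal to the earlier \<open>B i\<close>, which therefore stay
  fixed.\<close>

lemma gram_eq_imp_isometry:
  fixes B C :: "nat \<Rightarrow> quat"
  assumes "\<And>i j. i < n \<Longrightarrow> j < n \<Longrightarrow> B i \<bullet> B j = C i \<bullet> C j"
  shows "\<exists>T. quat_isometry T \<and> (\<forall>i<n. T (C i) = B i)"
  using assms
proof (induction n)
  case 0
  have "quat_isometry (\<lambda>x. 1 * x * 1)"
    unfolding quat_isometry_def by (intro exI [of _ 1]) auto
  then show ?case by auto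
next
  case (Suc n)
  then obtain T where T: "quat_isometry T" "\<And>i. i < n \<Longrightarrow> T (C i) = B i" by auto
  define v where "v = B n - T (C n)"
  show ?case
  proof (cases "v = 0")
    case True
    then show ?thesis using T by (auto simp: v_def less_Suc_eq)
  next
    case False
    define R where "R x = T x - (2 * (T x \<bullet> v) / (v \<bullet> v)) *\<^sub>R v" for x
    have "R (C i) = B i" if "i < n" for i
    proof -
      have "B i \<bullet> T (C n) = C i \<bullet> C n"
        using T(2) [OF that] quat_isometry_inner [OF T(1), of "C i" "C n"] by simp
      then have "B i \<bullet> v = 0" using Suc.prems [of i n] that by (simp add: v_def inner_diff_right)
      then show ?thesis by (simp add: R_def T(2) that)
    qed
    moreover have "R (C n) = B n"
    proof -
      \<comment> \<open>Two vectors of equal length are exchanged by the reflection along their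
        difference.\<close>
      have "B n \<bullet> B n = T (C n) \<bullet> T (C n)"
        using Suc.prems [of n n] quat_isometry_inner [OF T(1), of "C n" "C n"] by simp
      then have "v \<bullet> v = - 2 * (T (C n) \<bullet> v)"
        by (simp add: v_def inner_diff_left inner_diff_right inner_commute)
      moreover have "v \<bullet> v \<noteq> 0" using False by simp
      ultimately have "2 * (T (C n) \<bullet> v) / (v \<bullet> v) = -1" by (simp add: field_simps)
      then show ?thesis by (simp add: R_def v_def)
    qed
    moreover have "quat_isometry R"
      unfolding R_def by (rule quat_isometry_reflect [OF T(1) False])
    ultimately show ?thesis by (intro exI [of _ R]) (auto simp: less_Suc_eq)
  qed
qed

subsection \<open>Linear algebra in four dimensions\<close>

text \<open>The four scalars are packed into one quaternion, so that linear independence of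
  \<open>a\<close>, \<open>b\<close>, \<open>c\<close>, \<open>d\<close> becomes injectivity of a
  linear endomorphism.\<close>

definition comb :: "quat \<Rightarrow> quat \<Rightarrow> quat \<Rightarrow> quat \<Rightarrow> quat \<Rightarrow> quat" where
  "comb a b c d x = qRe x *\<^sub>R a + qI x *\<^sub>R b + qJ x *\<^sub>R c + qK x *\<^sub>R d"

lemma linear_comb: "linear (comb a b c d)"
  by (rule linearI) (simp_all add: comb_def algebra_simps)

lemma bil_eq_comb: "bil a b c d u v = comb a b c d (Quat 1 u v (u * v))"
  by (simp add: bil_def comb_def)

text \<open>If the coefficients form a basis, the coordinates 1, u, v, uv of a value satisfy 1 * uv
  = u * v, and the coordinate functionals are the adjoint of the inverse map applied to the standard
  basis. Otherwise all values are orthogonal to some nonzero \<open>n\<close>, and the square of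
  \<open>n \<bullet> x\<close> serves.\<close>

lemma bil_satisfies_quadratic_form:
  "\<exists>n1 n2 n3 n4 k. (n1 \<bullet> k) * (n2 \<bullet> k) - (n3 \<bullet> k) * (n4 \<bullet> k) \<noteq> 0 \<and>
     (\<forall>u v. (n1 \<bullet> bil a b c d u v) * (n2 \<bullet> bil a b c d u v)
            - (n3 \<bullet> bil a b c d u v) * (n4 \<bullet> bil a b c d u v) = 0)"
proof (cases "inj (comb a b c d)")
  case True
  then obtain S where S: "linear S" "\<And>x. S (comb a b c d x) = x"
    using linear_injective_isomorphism [OF linear_comb] by blast
  have adj: "adjoint S n \<bullet> x = n \<bullet> S x" for n x
    using adjoint_works [OF S(1), of x n] by (simp add: inner_commute)
  show ?thesis
  proof (intro exI conjI allI)
    show "(adjoint S (Quat 1 0 0 0) \<bullet> comb a b c d (Quat 1 0 0 1)) *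
      (adjoint S (Quat 0 0 0 1) \<bullet> comb a b c d (Quat 1 0 0 1)) -
      (adjoint S (Quat 0 1 0 0) \<bullet> comb a b c d (Quat 1 0 0 1)) *
      (adjoint S (Quat 0 0 1 0) \<bullet> comb a b c d (Quat 1 0 0 1)) \<noteq> 0"
      unfolding adj S(2) by (simp add: inner_quat_def)
    show "(adjoint S (Quat 1 0 0 0) \<bullet> bil a b c d u v) *
      (adjoint S (Quat 0 0 0 1) \<bullet> bil a b c d u v) -
      (adjoint S (Quat 0 1 0 0) \<bullet> bil a b c d u v) *
      (adjoint S (Quat 0 0 1 0) \<bullet> bil a b c d u v) = 0" for u v
      unfolding bil_eq_comb adj S(2) by (simp add: inner_quat_def)
  qed
next
  case False
  moreover have "surj (comb a b c d) \<Longrightarrow> inj (comb a b c d)"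
    by (rule linear_surjective_imp_injective [OF linear_comb]) simp_all
  ultimately have "\<not> surj (comb a b c d)" by blast
  moreover have "span (range (comb a b c d)) = range (comb a b c d)"
    using linear_subspace_image [OF linear_comb subspace_UNIV] by (simp add: span_eq_iff)
  ultimately have "span (range (comb a b c d)) \<noteq> UNIV" by metis
  then obtain n where "n \<noteq> 0" "\<forall>x\<in>span (range (comb a b c d)). n \<bullet> x = 0"
    using span_not_UNIV_orthogonal [of "range (comb a b c d)"] by blast
  then have n: "n \<noteq> 0" "\<And>x. n \<bullet> comb a b c d x = 0"
    by (simp_all add: span_base)
  show ?thesis
    by (rule exI [of _ n], rule exI [of _ n], rule exI [of _ 0], rule exI [of _ 0], rule exI [of _ n])
      (use n in \<open>simp add: bil_eq_comb\<close>)
qed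

text \<open>Commuting quaternions have parallel imaginary parts, so \<open>x\<close>,
  \<open>y\<close>, \<open>1\<close> are dependent over the reals, and the relation cannot involve
  \<open>1\<close> alone.\<close>

lemma commuting_imp_dependent:
  fixes x y :: quat
  assumes "x * y = y * x"
  obtains \<beta> \<gamma> \<delta> where "\<beta> \<noteq> 0 \<or> \<delta> \<noteq> 0" "\<beta> *\<^sub>R x + \<gamma> *\<^sub>R 1 + \<delta> *\<^sub>R y = 0"
proof -
  have cross: "qJ x * qK y = qK x * qJ y" "qK x * qI y = qI x * qK y" "qI x * qJ y = qJ x * qI y"
    using assms by (simp_all add: quat_eq_iff algebra_simps)
  consider "qI y \<noteq> 0" | "qJ y \<noteq> 0" | "qK y \<noteq> 0" | "qI y = 0" "qJ y = 0" "qK y = 0" by blast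
  then show ?thesis
  proof cases
    case 1
    then show ?thesis using cross
      by (intro that [of "qI y" "- qI x" "qI x * qRe y - qI y * qRe x"])
        (auto simp: quat_eq_iff algebra_simps)
  next
    case 2
    then show ?thesis using cross
      by (intro that [of "qJ y" "- qJ x" "qJ x * qRe y - qJ y * qRe x"])
        (auto simp: quat_eq_iff algebra_simps)
  next
    case 3
    then show ?thesis using cross
      by (intro that [of "qK y" "- qK x" "qK x * qRe y - qK y * qRe x"])
        (auto simp: quat_eq_iff algebra_simps)
  next
    case 4
    then show ?thesis
      by (intro that [of 0 1 "- qRe y"]) (auto simp: quat_eq_iff)
  qed
qed

text \<open>The hypothesis says that the determinant of the four vectors vanishes. If they spanned
  the space, the cross product of \<open>b\<close>, \<open>c\<close>, \<open>d\<close> would be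
  orthogonal to everything and hence 0; then \<open>b * qcnj d\<close> and \<open>c * qcnj d\<close>
  commute, which again yields a relation.\<close>

lemma det_zero_imp_dependent:
  fixes a b c d :: quat
  assumes "a \<bullet> (b * qcnj d * c - c * qcnj d * b) = 0"
  obtains x where "x \<noteq> 0" "comb a b c d x = 0"
proof (cases "inj (comb a b c d)")
  case True
  define X where "X = b * qcnj d * c - c * qcnj d * b"
  have "comb a b c d x \<bullet> X = 0" for x
    using assms inner_cross_eq_0 [where b = b and c = d and d = c]
    unfolding X_def [symmetric] comb_def by (simp add: inner_add_left)
  moreover have "surj (comb a b c d)"
    using linear_injective_imp_surjective [OF linear_comb True] by simp
  ultimately have "X \<bullet> X = 0" by (metis surjD)
  then have X: "b * qcnj d * c = c * qcnj d * b" by (simp add: X_def)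
  show ?thesis
  proof (cases "d = 0")
    case True
    then show ?thesis by (intro that [of "Quat 0 0 0 1"]) (simp_all add: comb_def quat_eq_iff)
  next
    case False
    have "(b * qcnj d) * (c * qcnj d) = (c * qcnj d) * (b * qcnj d)"
      using X by (simp add: mult.assoc [symmetric])
    then obtain \<beta> \<gamma> \<delta> where *: "\<beta> \<noteq> 0 \<or> \<delta> \<noteq> 0"
      "\<beta> *\<^sub>R (b * qcnj d) + \<gamma> *\<^sub>R 1 + \<delta> *\<^sub>R (c * qcnj d) = 0"
      by (rule commuting_imp_dependent)
    \<comment> \<open>Right multiplication by \<open>d\<close> turns \<open>qcnj d\<close> into a
      positive real factor and \<open>1\<close> into \<open>d\<close>.\<close>
    have "0 = (\<beta> *\<^sub>R (b * qcnj d) + \<gamma> *\<^sub>R 1 + \<delta> *\<^sub>R (c * qcnj d)) * d"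
      using *(2) by simp
    also have "\<dots> = comb a b c d (Quat 0 (\<beta> * (norm d)\<^sup>2) (\<delta> * (norm d)\<^sup>2) \<gamma>)"
      by (simp add: comb_def distrib_right mult.assoc mult_qcnj)
    finally show ?thesis
      using *(1) False by (intro that) (auto simp: quat_eq_iff)
  qed
next
  case False
  then show ?thesis
    using that linear_injective_0 [OF linear_comb] by blast
qed

subsection \<open>The quotient of two bilinear polynomials\<close>

text \<open>The hypothesis makes the 2 by 2 matrix of the four numbers singular, so it is an outer
  product of two vectors; both are then written in polar coordinates. The singular directions thus
  form a compact torus, including the limits for infinite parameters.\<close>

lemma singular_trig:
  fixes x0 x1 x2 x3 :: real
  assumes "x0 * x3 = x1 * x2"
  obtains r \<alpha> \<beta> where "x0 = r * (cos \<alpha> * cos \<beta>)" "x1 = r * (sin \<alpha> * cos \<beta>)"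
    "x2 = r * (cos \<alpha> * sin \<beta>)" "x3 = r * (sin \<alpha> * sin \<beta>)"
proof -
  obtain p1 p2 q1 q2 where *: "x0 = p1 * q1" "x1 = p2 * q1" "x2 = p1 * q2" "x3 = p2 * q2"
  proof (cases "x0 = 0")
    case True
    show ?thesis
    proof (cases "x1 = 0")
      case False
      then show ?thesis using that [of x0 1 x1 "x3 / x1"] True assms by simp
    qed (use that [of x2 0 x3 1] True in simp)
  qed (use that [of x0 1 x1 "x2 / x0"] assms in \<open>simp add: field_simps\<close>)
  obtain r1 \<alpha> where "p1 = r1 * cos \<alpha>" "p2 = r1 * sin \<alpha>" using polar_Ex by blast
  moreover obtain r2 \<beta> where "q1 = r2 * cos \<beta>" "q2 = r2 * sin \<beta>" using polar_Ex by blast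
  ultimately show ?thesis using * that [of "r1 * r2" \<alpha> \<beta>] by simp
qed

text \<open>A quotient of this shape sweeps out a two-dimensional set, which cannot fill \<open>S\<^sup>3\<close>.\<close>

lemma torus_misses_point:
  fixes B C :: "real \<Rightarrow> real \<Rightarrow> quat"
  assumes "B = (\<lambda>\<alpha> \<beta>. comb b0 b1 b2 b3 (Quat (cos \<alpha> * cos \<beta>) (sin \<alpha> * cos \<beta>) (cos \<alpha> * sin \<beta>) (sin \<alpha> * sin \<beta>)))"
    and "C = (\<lambda>\<alpha> \<beta>. comb c0 c1 c2 c3 (Quat (cos \<alpha> * cos \<beta>) (sin \<alpha> * cos \<beta>) (cos \<alpha> * sin \<beta>) (sin \<alpha> * sin \<beta>)))"
  shows "\<exists>y\<in>S3. \<forall>\<alpha> \<beta>. C \<alpha> \<beta> \<noteq> 0 \<longrightarrow> B \<alpha> \<beta> \<noteq> y * C \<alpha> \<beta>"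
proof (rule ccontr)
  assume "\<not> ?thesis"
  then have surj: "\<exists>\<alpha> \<beta>. C \<alpha> \<beta> \<noteq> 0 \<and> B \<alpha> \<beta> = y * C \<alpha> \<beta>" if "y \<in> S3" for y
    using that by blast
  \<comment> \<open>The cone over the quotients is a differentiable image of a subset of
    three-space, hence negligible; if every point of \<open>S3\<close> were a quotient, the cone
    would contain all nonzero quaternions.\<close>
  define F :: "real \<times> real \<times> real \<Rightarrow> quat" where
    "F z = fst z *\<^sub>R (B (fst (snd z)) (snd (snd z)) * inverse (C (fst (snd z)) (snd (snd z))))" for z
  define S where "S = {z :: real \<times> real \<times> real. C (fst (snd z)) (snd (snd z)) \<noteq> 0}"
  have "F differentiable (at z within S)" if z: "z \<in> S" for z
  proof -
    have nz: "C (fst (snd z)) (snd (snd z)) \<noteq> 0" using z by (simp add: S_def)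
    have *: "(\<lambda>z. comb a0 a1 a2 a3 (Quat (cos (fst (snd z)) * cos (snd (snd z))) (sin (fst (snd z)) * cos (snd (snd z)))
       (cos (fst (snd z)) * sin (snd (snd z))) (sin (fst (snd z)) * sin (snd (snd z))))) differentiable (at z within S)"
      for a0 a1 a2 a3
      unfolding comb_def quat.sel differentiable_def
      by (rule exI) (auto intro!: derivative_eq_intros)
    have B: "(\<lambda>z. B (fst (snd z)) (snd (snd z))) differentiable (at z within S)"
      unfolding assms(1) by (rule *)
    have "(\<lambda>z. C (fst (snd z)) (snd (snd z))) differentiable (at z within S)"
      unfolding assms(2) by (rule *)
    then have "(\<lambda>z. inverse (C (fst (snd z)) (snd (snd z)))) differentiable (at z within S)"
      unfolding differentiable_def using Deriv.has_derivative_inverse [where f = "\<lambda>z. C (fst (snd z)) (snd (snd z))", OF nz] by fast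
    moreover have "fst differentiable (at z within S)"
      unfolding differentiable_def by (rule exI, rule has_derivative_fst, rule has_derivative_ident)
    ultimately show ?thesis
      unfolding F_def using B by (intro differentiable_scaleR differentiable_mult)
  qed
  then have "negligible (F ` S)"
    by (intro negligible_differentiable_image_lowdim)
      (auto simp: differentiable_on_def Basis_quat_def DIM_prod card_insert_if)
  moreover have "UNIV - {0} \<subseteq> F ` S"
  proof
    fix x :: quat assume "x \<in> UNIV - {0}"
    then have x: "norm x \<noteq> 0" by simp
    then have "x /\<^sub>R norm x \<in> S3" by (simp add: S3_def)
    then obtain \<alpha> \<beta> where *: "C \<alpha> \<beta> \<noteq> 0" "B \<alpha> \<beta> = (x /\<^sub>R norm x) * C \<alpha> \<beta>" using surj by blast
    then have "F (norm x, \<alpha>, \<beta>) = x" using x by (simp add: F_def mult.assoc)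
    moreover have "(norm x, \<alpha>, \<beta>) \<in> S" using * by (simp add: S_def)
    ultimately show "x \<in> F ` S" by (metis imageI)
  qed
  ultimately have "negligible (UNIV - {0::quat})" using negligible_subset by blast
  then have "negligible (insert 0 (UNIV - {0::quat}))" by (simp only: negligible_insert)
  then show False using non_negligible_UNIV by (simp add: insert_UNIV)
qed

text \<open>\<open>x * x + x * qcnj x = x * (x + qcnj x)\<close>, and the last factor is real.
  Adding 1 to the unit quaternion obtained from \<open>x * x\<close> thus recovers \<open>x\<close>
  up to a real factor.\<close>

lemma one_plus_square:
  fixes x :: quat assumes "x \<noteq> 0"
  shows "1 + (x * x) /\<^sub>R (norm x)\<^sup>2 = (2 * qRe x / (norm x)\<^sup>2) *\<^sub>R x"
proof -
  have "(norm x)\<^sup>2 *\<^sub>R 1 + x * x = (2 * qRe x) *\<^sub>R x"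
    unfolding norm_quat_sq by (simp add: quat_eq_iff power2_eq_square algebra_simps)
  then have "((norm x)\<^sup>2 *\<^sub>R 1 + x * x) /\<^sub>R (norm x)\<^sup>2 = ((2 * qRe x) *\<^sub>R x) /\<^sub>R (norm x)\<^sup>2"
    by simp
  then show ?thesis
    using assms by (simp add: scaleR_add_right divide_inverse mult.commute)
qed

text \<open>With \<open>X = q * qcnj C\<close> the equation says that \<open>q * qcnj p * y\<close>
  is the normalised square of \<open>X\<close>. Hence \<open>1 + q * qcnj p * y\<close> is a real
  multiple of \<open>X\<close>, and a quadratic form vanishing on all values of \<open>X\<close>
  gives a quadratic equation for \<open>y\<close>.\<close>

lemma bil_quotient_conj_on_quadric:
  assumes "norm p = 1" "norm q = 1"
  shows "on_quadric {y \<in> S3. \<exists>u v. bil c0 c1 c2 c3 u v \<noteq> 0 \<and>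
    p * qcnj (bil c0 c1 c2 c3 u v) * q = y * bil c0 c1 c2 c3 u v}"
proof -
  obtain n1 n2 n3 n4 k where nz: "(n1 \<bullet> k) * (n2 \<bullet> k) - (n3 \<bullet> k) * (n4 \<bullet> k) \<noteq> 0"
    and z: "\<And>u v. (n1 \<bullet> bil (q * qcnj c0) (q * qcnj c1) (q * qcnj c2) (q * qcnj c3) u v) *
        (n2 \<bullet> bil (q * qcnj c0) (q * qcnj c1) (q * qcnj c2) (q * qcnj c3) u v)
      - (n3 \<bullet> bil (q * qcnj c0) (q * qcnj c1) (q * qcnj c2) (q * qcnj c3) u v) *
        (n4 \<bullet> bil (q * qcnj c0) (q * qcnj c1) (q * qcnj c2) (q * qcnj c3) u v) = 0"
    using bil_satisfies_quadratic_form
      [of "q * qcnj c0" "q * qcnj c1" "q * qcnj c2" "q * qcnj c3"] by blast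
  define Q where "Q x = (n1 \<bullet> x) * (n2 \<bullet> x) - (n3 \<bullet> x) * (n4 \<bullet> x)" for x
  have Q_scale: "Q (r *\<^sub>R x) = r\<^sup>2 * Q x" for r x
    by (simp add: Q_def power2_eq_square algebra_simps)
  have Q0: "Q (q * qcnj (bil c0 c1 c2 c3 u v)) = 0" for u v
    using z unfolding Q_def bil_qcnj bil_mult by blast
  \<comment> \<open>A nonzero real part keeps the real factor in \<open>one_plus_square\<close> from
    vanishing. Along \<open>k + t *\<^sub>R 1\<close> the form is a polynomial in \<open>t\<close>
    with constant term \<open>Q k \<noteq> 0\<close>, so it is nonzero for some admissible
    \<open>t\<close>.\<close>
  obtain x where x: "Q x \<noteq> 0" "qRe x \<noteq> 0"
  proof -
    define r0 where "r0 = Q k"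
    define r2 where "r2 = Q 1"
    define r1 where "r1 = (n1 \<bullet> k) * (n2 \<bullet> 1) + (n1 \<bullet> 1) * (n2 \<bullet> k) - (n3 \<bullet> k) * (n4 \<bullet> 1) - (n3 \<bullet> 1) * (n4 \<bullet> k)"
    have e: "Q (k + t *\<^sub>R 1) = r0 + r1 * t + r2 * t\<^sup>2" for t
      by (simp add: Q_def r0_def r1_def r2_def inner_add_right algebra_simps power2_eq_square)
    have "r0 \<noteq> 0" using nz by (simp add: r0_def Q_def)
    moreover have "infinite (- {- qRe k})" by (simp add: infinite_UNIV_char_0)
    ultimately obtain t where "t \<in> - {- qRe k}" "r0 + r1 * t + r2 * t\<^sup>2 \<noteq> 0"
      using quadratic_coeffs_zero by blast
    then show ?thesis using that [of "k + t *\<^sub>R 1"] e by simp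
  qed
  define f where "f y = Q (1 + q * qcnj p * y)" for y
  have "quadfun f"
    unfolding f_def Q_def
    by (intro quadfun_diff quadfun_mult affine_map_inner affine_map_intros)
  moreover have "\<exists>y\<in>S3. f y \<noteq> 0"
  proof
    have x0: "x \<noteq> 0" using x(2) by auto
    \<comment> \<open>The point of \<open>S3\<close> is chosen so that \<open>q * qcnj p\<close>
      takes it to \<open>?z\<close>, and \<open>1 + ?z\<close> is a nonzero multiple of
      \<open>x\<close>.\<close>
    let ?z = "(x * x) /\<^sub>R (norm x)\<^sup>2"
    have "norm ?z = 1" using x0 by (simp add: norm_mult power2_eq_square field_simps)
    then show "p * qcnj q * ?z \<in> S3" using assms by (simp add: S3_def norm_mult)
    have z: "q * qcnj p * (p * qcnj q * ?z) = ?z"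
      using assms by (simp add: mult.assoc qcnj_unit_left)
    have "f (p * qcnj q * ?z) = Q ((2 * qRe x / (norm x)\<^sup>2) *\<^sub>R x)"
      unfolding f_def z one_plus_square [OF x0] ..
    then show "f (p * qcnj q * ?z) \<noteq> 0" using x x0 by (simp add: Q_scale)
  qed
  moreover have "f y = 0" if "C = bil c0 c1 c2 c3 u v" "C \<noteq> 0" "p * qcnj C * q = y * C" for y u v C
  proof -
    define X where "X = q * qcnj C"
    have X: "X \<noteq> 0" "norm X = norm C" using that assms by (auto simp: X_def norm_mult)
    have "(q * qcnj p * y) * C * qcnj C = q * qcnj p * (p * qcnj C * q) * qcnj C"
      using that(3) by (simp add: mult.assoc)
    also have "\<dots> = X * X" using assms by (simp add: X_def mult.assoc qcnj_unit_left)
    finally have "(norm X)\<^sup>2 *\<^sub>R (q * qcnj p * y) = X * X"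
      by (simp add: mult.assoc mult_qcnj X)
    then have "q * qcnj p * y = (X * X) /\<^sub>R (norm X)\<^sup>2"
      using X by (metis divideR_right norm_eq_zero zero_eq_power2)
    then have "f y = Q ((2 * qRe X / (norm X)\<^sup>2) *\<^sub>R X)"
      unfolding f_def using one_plus_square [OF X(1)] by simp
    then show ?thesis using Q0 [of u v] unfolding X_def that(1) Q_scale by simp
  qed
  ultimately show ?thesis unfolding on_quadric_def by blast
qed

text \<open>Here \<open>qcnj p * y\<close> is conjugate to \<open>q\<close>, so it has the same real
  part: \<open>y\<close> lies on a hyperplane.\<close>

lemma bil_quotient_aut_on_quadric:
  assumes "norm p = 1" "norm q = 1"
  shows "on_quadric {y \<in> S3. \<exists>c. c \<noteq> 0 \<and> p * c * q = y * c}"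
proof -
  define f where "f y = qRe (qcnj p * y) - qRe q" for y
  have "quadfun f"
    unfolding f_def
    by (intro quadfun_diff quadfun_affine affine_map_sel(1) affine_fun_const affine_map_intros)
  moreover have "\<exists>y\<in>S3. f y \<noteq> 0"
  proof -
    \<comment> \<open>The values at the two antipodal points differ by 2, so they are not both
      0.\<close>
    have "f p = 1 - qRe q" "f (- p) = - 1 - qRe q"
      unfolding f_def using assms by (simp_all only: qcnj_unit mult_minus_right quat_one_sel quat_add_group_sel)
    moreover have "p \<in> S3" "- p \<in> S3" using assms by (simp_all add: S3_def)
    moreover have "f p \<noteq> 0 \<or> f (- p) \<noteq> 0" unfolding calculation(1,2) by linarith
    ultimately show ?thesis by blast
  qed
  moreover have "f y = 0" if "c \<noteq> 0" "p * c * q = y * c" for y c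
  proof -
    have "y = p * c * q * inverse c" using that by (simp add: mult.assoc)
    then have "qcnj p * y = c * q * inverse c" using assms by (simp add: mult.assoc qcnj_unit_left)
    then have "qRe (qcnj p * y) = qRe (inverse c * (c * q))" by (simp only: qRe_mult_commute [of "c * q" "inverse c"])
    also have "\<dots> = qRe q" using that(1) by (simp add: mult.assoc [symmetric] del: quat_times_sel)
    finally show ?thesis by (simp add: f_def del: quat_times_sel)
  qed
  ultimately show ?thesis unfolding on_quadric_def by blast
qed

lemma norm_comb:
  "(norm (comb a b c d x))\<^sup>2 = (norm a)\<^sup>2 * (qRe x)\<^sup>2 + (norm b)\<^sup>2 * (qI x)\<^sup>2 + (norm c)\<^sup>2 * (qJ x)\<^sup>2
     + (norm d)\<^sup>2 * (qK x)\<^sup>2 + 2 * (a \<bullet> b) * (qRe x * qI x) + 2 * (a \<bullet> c) * (qRe x * qJ x)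
     + 2 * (a \<bullet> d) * (qRe x * qK x) + 2 * (b \<bullet> c) * (qI x * qJ x) + 2 * (b \<bullet> d) * (qI x * qK x)
     + 2 * (c \<bullet> d) * (qJ x * qK x)"
  unfolding power2_norm_eq_inner comb_def
  by (simp add: inner_add_left inner_add_right inner_commute power2_eq_square algebra_simps)

lemma bil_quotient_on_quadric:
  assumes grid: "param_grid s t D"
    and norm_eq: "\<forall>w\<in>D. norm (bil b0 b1 b2 b3 (s w) (t w)) = norm (bil c0 c1 c2 c3 (s w) (t w))"
  shows "on_quadric {y \<in> S3. \<exists>u v. bil c0 c1 c2 c3 u v \<noteq> 0 \<and>
    bil b0 b1 b2 b3 u v = y * bil c0 c1 c2 c3 u v}"
proof -
  have "((norm b0)\<^sup>2 - (norm c0)\<^sup>2 + 2 * (b0 \<bullet> b1 - c0 \<bullet> c1) * s w + ((norm b1)\<^sup>2 - (norm c1)\<^sup>2) * (s w)\<^sup>2)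
     + (2 * (b0 \<bullet> b2 - c0 \<bullet> c2) + 2 * ((b0 \<bullet> b3 - c0 \<bullet> c3) + (b1 \<bullet> b2 - c1 \<bullet> c2)) * s w
        + 2 * (b1 \<bullet> b3 - c1 \<bullet> c3) * (s w)\<^sup>2) * t w
     + ((norm b2)\<^sup>2 - (norm c2)\<^sup>2 + 2 * (b2 \<bullet> b3 - c2 \<bullet> c3) * s w + ((norm b3)\<^sup>2 - (norm c3)\<^sup>2) * (s w)\<^sup>2) * (t w)\<^sup>2 = 0"
    if "w \<in> D" for w
  proof -
    have "(norm (bil b0 b1 b2 b3 (s w) (t w)))\<^sup>2 = (norm (bil c0 c1 c2 c3 (s w) (t w)))\<^sup>2"
      using norm_eq that by simp
    then show ?thesis unfolding norm_bil by (simp add: algebra_simps)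
  qed
  note coeffs = grid_coeffs_zero [OF grid this]
  have gram: "(norm b0)\<^sup>2 = (norm c0)\<^sup>2" "(norm b1)\<^sup>2 = (norm c1)\<^sup>2" "(norm b2)\<^sup>2 = (norm c2)\<^sup>2"
    "(norm b3)\<^sup>2 = (norm c3)\<^sup>2" "b0 \<bullet> b1 = c0 \<bullet> c1" "b0 \<bullet> b2 = c0 \<bullet> c2" "b1 \<bullet> b3 = c1 \<bullet> c3" "b2 \<bullet> b3 = c2 \<bullet> c3"
    and g': "b1 \<bullet> b2 - c1 \<bullet> c2 = - (b0 \<bullet> b3 - c0 \<bullet> c3)"
    using coeffs by simp_all
  \<comment> \<open>The only possible discrepancy of the two Gram matrices: \<open>g\<close> at
    position (0, 3) and \<open>- g\<close> at position (1, 2).\<close>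
  define g where "g = b0 \<bullet> b3 - c0 \<bullet> c3"
  show ?thesis
  proof (cases "g = 0")
    case True
    have "\<exists>T. quat_isometry T \<and> (\<forall>i<4. T ([c0, c1, c2, c3] ! i) = [b0, b1, b2, b3] ! i)"
    proof (rule gram_eq_imp_isometry)
      fix i j :: nat
      assume "i < 4" "j < 4"
      then have "i \<in> {0, 1, 2, 3}" "j \<in> {0, 1, 2, 3}" by auto
      then show "[b0, b1, b2, b3] ! i \<bullet> [b0, b1, b2, b3] ! j = [c0, c1, c2, c3] ! i \<bullet> [c0, c1, c2, c3] ! j"
        using gram g' True unfolding g_def power2_norm_eq_inner
        by (auto simp: inner_commute numeral_3_eq_3 numeral_2_eq_2)
    qed
    then obtain T where T: "quat_isometry T" "\<forall>i<4. T ([c0, c1, c2, c3] ! i) = [b0, b1, b2, b3] ! i"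
      by blast
    have b: "b0 = T c0" "b1 = T c1" "b2 = T c2" "b3 = T c3"
      using T(2) [rule_format, of 0] T(2) [rule_format, of 1] T(2) [rule_format, of 2]
        T(2) [rule_format, of 3] by simp_all
    obtain p q where pq: "norm p = 1" "norm q = 1" "T = (\<lambda>x. p * x * q) \<or> T = (\<lambda>x. p * qcnj x * q)"
      using T(1) unfolding quat_isometry_def by blast
    from pq(3) show ?thesis
    proof
      assume "T = (\<lambda>x. p * x * q)"
      then have "bil b0 b1 b2 b3 u v = p * bil c0 c1 c2 c3 u v * q" for u v
        unfolding b by (simp add: bil_mult)
      then show ?thesis
        by (intro on_quadric_mono [OF bil_quotient_aut_on_quadric [OF pq(1,2)]]) auto
    next
      assume "T = (\<lambda>x. p * qcnj x * q)"
      then have "bil b0 b1 b2 b3 u v = p * qcnj (bil c0 c1 c2 c3 u v) * q" for u v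
        unfolding b by (simp add: bil_mult bil_qcnj)
      then show ?thesis
        using bil_quotient_conj_on_quadric [OF pq(1,2)] by simp
    qed
  next
    case False
    \<comment> \<open>On \<open>S3\<close> this is \<open>qcnj (b - y * c) * (b' - y * c')\<close>.
      The term containing \<open>qcnj y * y\<close> is replaced by its value there, which leaves an
      expression affine in \<open>y\<close>.\<close>
    define E where "E b c b' c' y = qcnj b * b' + qcnj c * c' - qcnj c * qcnj y * b' - qcnj b * y * c'"
      for b c b' c' y
    have E: "E b c b' c' y = qcnj (b - y * c) * (b' - y * c')" if "y \<in> S3" for b c b' c' y
    proof -
      have "qcnj y * (y * c') = c'"
        using that by (simp add: S3_def qcnj_unit_left)
      then show ?thesis unfolding E_def by (simp add: algebra_simps)
    qed
    have aff: "affine_map (E b c b' c')" for b c b' c'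
      unfolding E_def by (intro affine_map_intros)
    \<comment> \<open>Twice the determinant, up to sign, of the four vectors
      \<open>b0 - y * c0\<close>, ..., \<open>b3 - y * c3\<close> for \<open>y\<close> on
      \<open>S3\<close>. Each of its two terms is the real part of a product of two affine maps, so
      the degree drops from 4 to 2.\<close>
    define f where "f y = qRe (E b0 c0 b1 c1 y * E b3 c3 b2 c2 y) - qRe (E b0 c0 b2 c2 y * E b3 c3 b1 c1 y)" for y
    define d0 where "d0 y = b0 - y * c0" for y
    define d1 where "d1 y = b1 - y * c1" for y
    define d2 where "d2 y = b2 - y * c2" for y
    define d3 where "d3 y = b3 - y * c3" for y
    have f: "f y = d0 y \<bullet> (d1 y * qcnj (d3 y) * d2 y - d2 y * qcnj (d3 y) * d1 y)" if "y \<in> S3" for y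
      unfolding inner_diff_right
      unfolding f_def E [OF that] inner_quat_Re d0_def d1_def d2_def d3_def
      by (simp only: mult.assoc)
    have "quadfun f"
      unfolding f_def by (intro quadfun_diff quadfun_Re_mult aff)
    moreover have "f y = 0" if "y \<in> S3" "bil b0 b1 b2 b3 u v = y * bil c0 c1 c2 c3 u v" for y u v
    proof -
      have "bil (d0 y) (d1 y) (d2 y) (d3 y) u v = 0"
        using that(2) by (simp add: d0_def d1_def d2_def d3_def bil_diff [symmetric] bil_mult)
      then have d0: "d0 y = - (u *\<^sub>R d1 y + v *\<^sub>R d2 y + (u * v) *\<^sub>R d3 y)"
        unfolding bil_def by (simp only: eq_neg_iff_add_eq_0 add.assoc)
      show ?thesis
        unfolding f [OF that(1)] d0 inner_minus_left inner_add_left inner_scaleR_left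
        using inner_cross_eq_0 [where b = "d1 y" and c = "d3 y" and d = "d2 y"] by simp
    qed
    moreover have "\<exists>y\<in>S3. f y \<noteq> 0"
    proof -
      \<comment> \<open>A point missed by the quotient on the whole torus; the determinant is shown
        to be nonzero there.\<close>
      obtain y where y: "y \<in> S3" and miss: "\<And>\<alpha> \<beta>.
          comb c0 c1 c2 c3 (Quat (cos \<alpha> * cos \<beta>) (sin \<alpha> * cos \<beta>) (cos \<alpha> * sin \<beta>) (sin \<alpha> * sin \<beta>)) \<noteq> 0 \<Longrightarrow>
          comb b0 b1 b2 b3 (Quat (cos \<alpha> * cos \<beta>) (sin \<alpha> * cos \<beta>) (cos \<alpha> * sin \<beta>) (sin \<alpha> * sin \<beta>)) \<noteq>
          y * comb c0 c1 c2 c3 (Quat (cos \<alpha> * cos \<beta>) (sin \<alpha> * cos \<beta>) (cos \<alpha> * sin \<beta>) (sin \<alpha> * sin \<beta>))"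
        using torus_misses_point [OF refl refl, of c0 c1 c2 c3 b0 b1 b2 b3] by blast
      have "f y \<noteq> 0"
      proof
        assume "f y = 0"
        then have "d0 y \<bullet> (d1 y * qcnj (d3 y) * d2 y - d2 y * qcnj (d3 y) * d1 y) = 0"
          using f [OF y] by simp
        then obtain x where x: "x \<noteq> 0" "comb (d0 y) (d1 y) (d2 y) (d3 y) x = 0"
          by (rule det_zero_imp_dependent)
        have eq: "comb b0 b1 b2 b3 x = y * comb c0 c1 c2 c3 x"
          using x(2) by (simp add: comb_def d0_def d1_def d2_def d3_def algebra_simps)
        \<comment> \<open>The Gram matrices cancel except for the entries containing
          \<open>g\<close>, so equal norms force \<open>x\<close> to be singular, that is, a
          multiple of a point of the torus.\<close>
        then have "(norm (comb b0 b1 b2 b3 x))\<^sup>2 = (norm (comb c0 c1 c2 c3 x))\<^sup>2"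
          using y by (simp add: norm_mult S3_def)
        moreover have "b1 \<bullet> b2 = c1 \<bullet> c2 - g" "b0 \<bullet> b3 = c0 \<bullet> c3 + g" using g' by (simp_all add: g_def)
        ultimately have "2 * g * (qRe x * qK x - qI x * qJ x) = 0"
          unfolding norm_comb gram by (simp add: algebra_simps)
        then have sing: "qRe x * qK x = qI x * qJ x" using False by simp
        obtain r \<alpha> \<beta> where xs: "qRe x = r * (cos \<alpha> * cos \<beta>)" "qI x = r * (sin \<alpha> * cos \<beta>)"
          "qJ x = r * (cos \<alpha> * sin \<beta>)" "qK x = r * (sin \<alpha> * sin \<beta>)"
          using singular_trig [OF sing] by blast
        define z where "z = Quat (cos \<alpha> * cos \<beta>) (sin \<alpha> * cos \<beta>) (cos \<alpha> * sin \<beta>) (sin \<alpha> * sin \<beta>)"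
        have xz: "x = r *\<^sub>R z" by (simp add: quat_eq_iff xs z_def)
        then have r: "r \<noteq> 0" using x(1) by auto
        have "comb b0 b1 b2 b3 z = y * comb c0 c1 c2 c3 z"
          using eq r unfolding xz linear_scale [OF linear_comb] by simp
        \<comment> \<open>By the choice of \<open>y\<close>, only a common zero of both combinations
          is left. Pairing these with each coefficient then isolates \<open>g\<close> times a
          coordinate of \<open>x\<close>.\<close>
        then have c0: "comb c0 c1 c2 c3 z = 0" using miss [of \<alpha> \<beta>] unfolding z_def by blast
        then have "comb c0 c1 c2 c3 x = 0" "comb b0 b1 b2 b3 x = 0"
          using eq unfolding xz linear_scale [OF linear_comb] by simp_all
        then have "b' \<bullet> comb b0 b1 b2 b3 x - c' \<bullet> comb c0 c1 c2 c3 x = 0" for b' c'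
          by simp
        from this [of b0 c0] this [of b1 c1] this [of b2 c2] this [of b3 c3]
        have "g * qK x = 0" "g * qJ x = 0" "g * qI x = 0" "g * qRe x = 0"
          using gram \<open>b1 \<bullet> b2 = c1 \<bullet> c2 - g\<close> \<open>b0 \<bullet> b3 = c0 \<bullet> c3 + g\<close>
          by (simp_all add: comb_def inner_add_right power2_norm_eq_inner inner_commute algebra_simps)
        then show False using False x(1) by (simp add: quat_eq_iff)
      qed
      then show ?thesis using y by blast
    qed
    ultimately show ?thesis unfolding on_quadric_def by blast
  qed
qed

subsection \<open>Surfaces with one trivial denominator\<close>

text \<open>The conclusion of the theorem for an arbitrary set, so that each case can choose its own
  parameters and normalisation.\<close>

definition classified :: "quat set \<Rightarrow> bool" where
  "classified X \<longleftrightarrow>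
     (X \<subseteq> ImH \<longrightarrow> (\<exists>S. (euclidean_translational S \<or> darboux_cyclide S) \<and> X \<subseteq> S)) \<and>
     (X \<subseteq> S3 \<longrightarrow> (\<exists>S. clifford_translational S \<and> X \<subseteq> S) \<or> (\<exists>Y. other_quadric Y \<and> X \<subseteq> S3 \<inter> Y))"

lemma on_quadric_qcnj: assumes "on_quadric (qcnj ` X)" shows "on_quadric X"
proof -
  obtain f y where f: "quadfun f" "y \<in> S3" "f y \<noteq> 0" "\<forall>y\<in>qcnj ` X. f y = 0"
    using assms unfolding on_quadric_def by blast
  have "quadfun (\<lambda>y. f (qcnj y))" by (rule quadfun_compose_affine [OF f(1) affine_map_intros(3)])
  moreover have "qcnj y \<in> S3" "f (qcnj (qcnj y)) \<noteq> 0" using f by (simp_all add: S3_def)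
  ultimately show ?thesis
    using f(4) unfolding on_quadric_def
    by (intro exI [of _ "\<lambda>y. f (qcnj y)"] conjI bexI [of _ "qcnj y"]) auto
qed

lemma classifiedI:
  assumes "X \<subseteq> S3 \<Longrightarrow> on_quadric X" "X \<subseteq> ImH \<Longrightarrow> on_quadric (cayley ` X)"
  shows "classified X"
  unfolding classified_def
  using on_quadric_imp_other_quadric cayley_on_quadric_imp_darboux assms by blast

lemma right_quotient_on_quadric:
  assumes grid: "param_grid s t D"
    and eq: "\<forall>w\<in>D. bil c0 c1 c2 c3 (s w) (t w) \<noteq> 0 \<and>
      bil b0 b1 b2 b3 (s w) (t w) = \<phi> w * bil c0 c1 c2 c3 (s w) (t w)"
    and S3: "\<phi> ` D \<subseteq> S3"
  shows "on_quadric (\<phi> ` D)"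
proof (rule on_quadric_mono)
  have "\<forall>w\<in>D. norm (bil b0 b1 b2 b3 (s w) (t w)) = norm (bil c0 c1 c2 c3 (s w) (t w))"
    using eq S3 by (auto simp: norm_mult S3_def)
  then show "on_quadric {y \<in> S3. \<exists>u v. bil c0 c1 c2 c3 u v \<noteq> 0 \<and>
      bil b0 b1 b2 b3 u v = y * bil c0 c1 c2 c3 u v}"
    by (rule bil_quotient_on_quadric [OF grid])
  show "\<phi> ` D \<subseteq> {y \<in> S3. \<exists>u v. bil c0 c1 c2 c3 u v \<noteq> 0 \<and>
      bil b0 b1 b2 b3 u v = y * bil c0 c1 c2 c3 u v}"
    using eq S3 by blast
qed

text \<open>If \<phi> is the quotient of B by C, its Cayley transform is the quotient of
  \<open>C + B\<close> by \<open>C - B\<close>, again of the same degrees. The new denominator is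
  nonzero because an imaginary quaternion is never 1.\<close>

lemma right_quotient_cayley_on_quadric:
  assumes grid: "param_grid s t D"
    and eq: "\<forall>w\<in>D. bil c0 c1 c2 c3 (s w) (t w) \<noteq> 0 \<and>
      bil b0 b1 b2 b3 (s w) (t w) = \<phi> w * bil c0 c1 c2 c3 (s w) (t w)"
    and ImH: "\<phi> ` D \<subseteq> ImH"
  shows "on_quadric ((\<lambda>w. cayley (\<phi> w)) ` D)"
proof (rule right_quotient_on_quadric [OF grid])
  let ?b = "bil (c0 + b0) (c1 + b1) (c2 + b2) (c3 + b3)" and ?c = "bil (c0 - b0) (c1 - b1) (c2 - b2) (c3 - b3)"
  show "\<forall>w\<in>D. ?c (s w) (t w) \<noteq> 0 \<and> ?b (s w) (t w) = cayley (\<phi> w) * ?c (s w) (t w)"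
  proof
    fix w assume w: "w \<in> D"
    have ne: "1 - \<phi> w \<noteq> 0" using ImH w by (auto simp: ImH_def quat_eq_iff)
    have "?c (s w) (t w) = (1 - \<phi> w) * bil c0 c1 c2 c3 (s w) (t w)"
      "?b (s w) (t w) = (1 + \<phi> w) * bil c0 c1 c2 c3 (s w) (t w)"
      using eq w by (simp_all add: bil_add [symmetric] bil_diff [symmetric] algebra_simps)
    then show "?c (s w) (t w) \<noteq> 0 \<and> ?b (s w) (t w) = cayley (\<phi> w) * ?c (s w) (t w)"
      using ne eq w by (simp add: cayley_def mult.assoc left_inverse [OF ne] mult.assoc [of "inverse _", symmetric])
  qed
  show "(\<lambda>w. cayley (\<phi> w)) ` D \<subseteq> S3" using ImH cayley_in_S3 by blast
qed

lemma right_quotient_classified: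
  assumes "param_grid s t D"
    and "\<forall>w\<in>D. bil c0 c1 c2 c3 (s w) (t w) \<noteq> 0 \<and>
      bil b0 b1 b2 b3 (s w) (t w) = \<phi> w * bil c0 c1 c2 c3 (s w) (t w)"
  shows "classified (\<phi> ` D)"
  using right_quotient_on_quadric [OF assms] right_quotient_cayley_on_quadric [OF assms]
  by (intro classifiedI) (simp_all add: image_image)

text \<open>Conjugation turns a left quotient into a right one. It preserves \<open>S3\<close> and
  \<open>ImH\<close>, commutes with \<open>cayley\<close> on \<open>ImH\<close>, and takes quadrics
  to quadrics.\<close>

lemma left_quotient_classified:
  assumes grid: "param_grid s t D"
    and eq: "\<forall>w\<in>D. bil c0 c1 c2 c3 (s w) (t w) \<noteq> 0 \<and>
      bil b0 b1 b2 b3 (s w) (t w) = bil c0 c1 c2 c3 (s w) (t w) * \<phi> w"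
  shows "classified (\<phi> ` D)"
proof -
  have *: "\<forall>w\<in>D. bil (qcnj c0) (qcnj c1) (qcnj c2) (qcnj c3) (s w) (t w) \<noteq> 0 \<and>
      bil (qcnj b0) (qcnj b1) (qcnj b2) (qcnj b3) (s w) (t w)
      = qcnj (\<phi> w) * bil (qcnj c0) (qcnj c1) (qcnj c2) (qcnj c3) (s w) (t w)"
    using eq by (simp add: bil_qcnj [symmetric])
  show ?thesis
  proof (rule classifiedI)
    assume "\<phi> ` D \<subseteq> S3"
    then have "(\<lambda>w. qcnj (\<phi> w)) ` D \<subseteq> S3" by (auto simp: S3_def)
    from right_quotient_on_quadric [OF grid * this] have "on_quadric (qcnj ` \<phi> ` D)"
      by (simp add: image_image)
    then show "on_quadric (\<phi> ` D)" by (rule on_quadric_qcnj)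
  next
    assume S: "\<phi> ` D \<subseteq> ImH"
    then have "(\<lambda>w. qcnj (\<phi> w)) ` D \<subseteq> ImH" by (auto simp: ImH_def)
    from right_quotient_cayley_on_quadric [OF grid * this]
    have "on_quadric ((\<lambda>w. cayley (qcnj (\<phi> w))) ` D)" .
    moreover have "cayley (qcnj (\<phi> w)) = qcnj (cayley (\<phi> w))" if "w \<in> D" for w
    proof -
      have "\<phi> w \<in> ImH" "qcnj (\<phi> w) \<in> ImH" using S that by (auto simp: ImH_def)
      then show ?thesis by (simp add: cayley_eq)
    qed
    ultimately have "on_quadric (qcnj ` cayley ` \<phi> ` D)"
      by (simp add: image_image cong: image_cong)
    then show "on_quadric (cayley ` \<phi> ` D)" by (rule on_quadric_qcnj)
  qed
qed

subsection \<open>Circles\<close>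

definition plane :: "quat \<Rightarrow> quat \<Rightarrow> quat \<Rightarrow> quat set" where
  "plane k m n = {k + x *\<^sub>R m + y *\<^sub>R n | x y. True}"

lemma planeI: "k + x *\<^sub>R m + y *\<^sub>R n \<in> plane k m n"
  unfolding plane_def by blast

lemma plane_affine:
  assumes "m \<noteq> 0" "n \<noteq> 0" "m \<bullet> n = 0"
  shows "affine (plane k m n)" "aff_dim (plane k m n) = 2"
proof -
  have "span {m, n} = {x *\<^sub>R m + y *\<^sub>R n | x y. True}"
    by (auto simp: span_insert [of m] span_singleton image_iff diff_eq_eq add.commute)
  then have *: "plane k m n = (+) k ` span {m, n}"
    unfolding plane_def by (auto simp: image_iff add.assoc)
  show "affine (plane k m n)"
    unfolding * by (simp add: affine_translation [symmetric] subspace_imp_affine)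
  have mn: "m \<noteq> n" using assms by auto
  have "pairwise orthogonal {m, n}"
    using assms(3) by (auto simp: pairwise_def orthogonal_def inner_commute)
  then have "independent {m, n}"
    using assms(1,2) by (intro pairwise_orthogonal_independent) auto
  then have "dim (span {m, n}) = 2"
    using mn by (simp add: dim_eq_card_independent)
  then show "aff_dim (plane k m n) = 2"
    unfolding * by (simp add: aff_dim_translation_eq aff_dim_subspace)
qed

text \<open>The image of a line under an inversion: a circle through \<open>k\<close>, reached for \<open>s \<rightarrow> \<infinity>\<close>.\<close>

definition inv_curve :: "quat \<Rightarrow> quat \<Rightarrow> quat \<Rightarrow> real \<Rightarrow> real \<Rightarrow> quat" where
  "inv_curve k m n g s = k + (s *\<^sub>R m + n) /\<^sub>R (s\<^sup>2 + g\<^sup>2)"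

lemma inv_curve_in_plane: "inv_curve k m n g s \<in> plane k m n"
  using planeI [of k "s / (s\<^sup>2 + g\<^sup>2)" m "1 / (s\<^sup>2 + g\<^sup>2)" n]
  by (simp add: inv_curve_def algebra_simps divide_inverse)

text \<open>The limit point \<open>k\<close> and the point \<open>k + n /\<^sub>R g\<^sup>2\<close>
  for \<open>s = 0\<close> are the ends of a diameter, which gives centre and radius.\<close>

lemma inv_curve_in_sphere:
  assumes "g > 0" "m \<bullet> n = 0" "norm n = g * norm m"
  shows "inv_curve k m n g s \<in> sphere (k + n /\<^sub>R (2 * g\<^sup>2)) (norm n / (2 * g\<^sup>2))"
proof -
  define e where "e = inverse (s\<^sup>2 + g\<^sup>2)"
  define h where "h = inverse (2 * g\<^sup>2)"
  have "s\<^sup>2 + g\<^sup>2 > 0" using assms(1) by (simp add: add_nonneg_pos)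
  then have e: "e * (s\<^sup>2 + g\<^sup>2) = 1" by (metis e_def left_inverse less_irrefl)
  have h: "2 * h * g\<^sup>2 = 1" "h \<ge> 0" using assms(1) by (simp_all add: h_def)
  have nn: "n \<bullet> n = g\<^sup>2 * (m \<bullet> m)"
    using assms(3) by (metis power2_norm_eq_inner power_mult_distrib)
  have *: "inv_curve k m n g s - (k + h *\<^sub>R n) = (s * e) *\<^sub>R m + (e - h) *\<^sub>R n"
    unfolding inv_curve_def e_def [symmetric] by (simp add: algebra_simps)
  have "(norm (inv_curve k m n g s - (k + h *\<^sub>R n)))\<^sup>2 = (s * e)\<^sup>2 * (m \<bullet> m) + (e - h)\<^sup>2 * (n \<bullet> n)"
    unfolding * power2_norm_eq_inner using assms(2)
    by (simp add: inner_add_left inner_add_right inner_commute power2_eq_square)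
  also have "\<dots> = h\<^sup>2 * (n \<bullet> n)"
    using e h(1) nn by algebra
  also have "\<dots> = (norm n * h)\<^sup>2"
    by (simp add: power_mult_distrib power2_norm_eq_inner)
  finally have "norm (inv_curve k m n g s - (k + h *\<^sub>R n)) = norm n * h"
    by (rule power2_eq_imp_eq) (use h(2) in auto)
  then show ?thesis
    unfolding divide_inverse h_def [symmetric] by (simp add: dist_norm norm_minus_commute)
qed

lemma inv_curve_in_circle_ImH:
  assumes "g > 0" "m \<bullet> n = 0" "norm n = g * norm m" "k \<in> ImH" "m \<in> ImH" "n \<in> ImH"
  shows "\<exists>\<alpha>. is_circle \<alpha> \<and> \<alpha> \<subseteq> ImH \<and> (\<forall>s. inv_curve k m n g s \<in> \<alpha>)"
proof (cases "m = 0")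
  case True
  \<comment> \<open>For \<open>m = 0\<close> also \<open>n = 0\<close>, and the curve is the single
    point \<open>k\<close>; any line through \<open>k\<close> in \<open>ImH\<close> will do.\<close>
  define l where "l = (+) k ` span {Quat 0 1 0 0}"
  have i: "Quat 0 1 0 0 \<noteq> 0" by (simp add: quat_eq_iff)
  have "straight_line l"
    unfolding straight_line_def l_def using i
    by (simp add: affine_translation [symmetric] subspace_imp_affine aff_dim_translation_eq aff_dim_subspace
        dim_eq_card_independent)
  moreover have "l \<subseteq> ImH" using assms(4) by (auto simp: l_def span_singleton ImH_def)
  moreover have "inv_curve k m n g s \<in> l" for s
    using True assms(3) by (auto simp: inv_curve_def l_def intro: image_eqI [of _ _ 0] span_zero)
  ultimately show ?thesis unfolding is_circle_def by blast
next
  case False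
  then have n: "n \<noteq> 0" using assms(1,3) by auto
  let ?S = "plane k m n \<inter> sphere (k + n /\<^sub>R (2 * g\<^sup>2)) (norm n / (2 * g\<^sup>2))"
  have "ordinary_circle ?S"
    unfolding ordinary_circle_def
  proof (intro exI conjI)
    show "affine (plane k m n)" "aff_dim (plane k m n) = 2"
      using plane_affine [OF False n assms(2)] by auto
    show "k + n /\<^sub>R (2 * g\<^sup>2) \<in> plane k m n"
      using planeI [of k 0 m "inverse (2 * g\<^sup>2)" n] by simp
  qed (use n assms(1) in auto)
  moreover have "?S \<subseteq> ImH" using assms(4-6) by (auto simp: plane_def ImH_def)
  ultimately show ?thesis
    unfolding is_circle_def using inv_curve_in_plane inv_curve_in_sphere [OF assms(1-3)] by blast
qed

text \<open>The centre is the foot \<open>c\<close> of the perpendicular from the origin to the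
  plane, and Pythagoras gives the radius. Of two distinct points of the intersection one differs
  from \<open>c\<close>, so the radius is positive.\<close>

lemma plane_Int_S3_circle:
  assumes "m \<noteq> 0" "n \<noteq> 0" "m \<bullet> n = 0" "x \<in> plane k m n \<inter> S3" "y \<in> plane k m n \<inter> S3" "x \<noteq> y"
  shows "ordinary_circle (plane k m n \<inter> S3)"
proof -
  define c where "c = k - (k \<bullet> m / (m \<bullet> m)) *\<^sub>R m - (k \<bullet> n / (n \<bullet> n)) *\<^sub>R n"
  have "m \<bullet> m \<noteq> 0" "n \<bullet> n \<noteq> 0" using assms by auto
  then have cm: "c \<bullet> m = 0" "c \<bullet> n = 0"
    using assms(3) by (simp_all add: c_def inner_diff_left inner_diff_right inner_commute)
  have pyth: "(norm z)\<^sup>2 = (norm c)\<^sup>2 + (dist c z)\<^sup>2" if z: "z \<in> plane k m n" for z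
  proof -
    obtain p q where "z = k + p *\<^sub>R m + q *\<^sub>R n" using z unfolding plane_def by blast
    then have "z - c = (p + k \<bullet> m / (m \<bullet> m)) *\<^sub>R m + (q + k \<bullet> n / (n \<bullet> n)) *\<^sub>R n"
      by (simp add: c_def algebra_simps)
    then have 0: "c \<bullet> (z - c) = 0" using cm by (simp add: inner_add_right)
    have "(norm (c + (z - c)))\<^sup>2 = (norm c)\<^sup>2 + (norm (z - c))\<^sup>2"
      unfolding power2_norm_eq_inner using 0
      by (simp only: inner_add_left inner_add_right inner_commute [of "z - c" c])
    then show ?thesis by (simp add: dist_norm norm_minus_commute)
  qed
  obtain z where z: "z \<in> plane k m n" "norm z = 1" "z \<noteq> c"
    using assms(4-6) unfolding S3_def by (metis IntE mem_Collect_eq)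
  then have "(dist c z)\<^sup>2 > 0" "(norm z)\<^sup>2 = 1" by simp_all
  then have pos: "1 - (norm c)\<^sup>2 > 0" using pyth [OF z(1)] by linarith
  have "plane k m n \<inter> S3 = plane k m n \<inter> sphere c (sqrt (1 - (norm c)\<^sup>2))"
  proof -
    have "norm z = 1 \<longleftrightarrow> dist c z = sqrt (1 - (norm c)\<^sup>2)" if "z \<in> plane k m n" for z
    proof -
      have "norm z = 1 \<longleftrightarrow> (norm z)\<^sup>2 = 1"
        using power2_eq_iff_nonneg [of "norm z" 1] by simp
      also have "\<dots> \<longleftrightarrow> (dist c z)\<^sup>2 = 1 - (norm c)\<^sup>2" using pyth [OF that] by auto
      also have "\<dots> \<longleftrightarrow> dist c z = sqrt (1 - (norm c)\<^sup>2)"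
        using pos power2_eq_iff_nonneg [of "dist c z" "sqrt (1 - (norm c)\<^sup>2)"] by simp
      finally show ?thesis .
    qed
    then show ?thesis by (auto simp: S3_def)
  qed
  moreover have "c \<in> plane k m n"
    using planeI [of k "- (k \<bullet> m / (m \<bullet> m))" m "- (k \<bullet> n / (n \<bullet> n))" n] by (simp add: c_def)
  ultimately show ?thesis
    unfolding ordinary_circle_def
    using plane_affine [OF assms(1-3), of k] pos by (metis real_sqrt_gt_zero)
qed

lemma inv_curve_in_circle_S3:
  assumes "g > 0" "m \<bullet> n = 0" "norm n = g * norm m" "k \<in> S3" "\<And>s. inv_curve k m n g s \<in> S3"
  shows "\<exists>\<alpha>. is_circle \<alpha> \<and> \<alpha> \<subseteq> S3 \<and> (\<forall>s. inv_curve k m n g s \<in> \<alpha>)"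
proof (cases "m = 0")
  case True
  \<comment> \<open>The curve is again the single point \<open>k\<close>; a great circle through
    \<open>k\<close> is chosen, in the plane of \<open>k\<close> and its orthogonal multiple
    \<open>?n\<close>.\<close>
  let ?n = "Quat 0 1 0 0 * k"
  have k: "k \<noteq> 0" using assms(4) by (auto simp: S3_def)
  then have "?n \<noteq> 0" by (simp add: quat_eq_iff [of "Quat 0 1 0 0"])
  moreover have "k \<bullet> ?n = 0" by (simp add: inner_quat_def algebra_simps)
  moreover have "k \<in> plane 0 k ?n \<inter> S3" "- k \<in> plane 0 k ?n \<inter> S3"
    using assms(4) planeI [of 0 1 k 0 ?n] planeI [of 0 "-1" k 0 ?n] by (simp_all add: S3_def)
  moreover have "k \<noteq> - k"
  proof
    assume "k = - k"
    then have "2 *\<^sub>R k = 0" by (metis add.right_inverse scaleR_2)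
    then show False using k by simp
  qed
  ultimately have "ordinary_circle (plane 0 k ?n \<inter> S3)"
    using k by (intro plane_Int_S3_circle)
  moreover have "inv_curve k m n g s = k" for s
    using True assms(3) by (simp add: inv_curve_def)
  ultimately show ?thesis
    using \<open>k \<in> plane 0 k ?n \<inter> S3\<close> unfolding is_circle_def by auto
next
  case False
  then have n: "n \<noteq> 0" using assms(1,3) by auto
  have "k \<in> plane k m n \<inter> S3" using assms(4) planeI [of k 0 m 0 n] by simp
  moreover have "inv_curve k m n g 0 \<in> plane k m n \<inter> S3" using assms(5) inv_curve_in_plane by blast
  moreover have "k \<noteq> inv_curve k m n g 0" using n assms(1) by (simp add: inv_curve_def)
  ultimately have "ordinary_circle (plane k m n \<inter> S3)"
    using False n assms(2) by (intro plane_Int_S3_circle)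
  then show ?thesis unfolding is_circle_def using inv_curve_in_plane assms(5) by blast
qed

section \<open>Linear fractions with imaginary constant term as such circular curves\<close>

lemma inverse_linear:
  assumes "qRe a = 0"
  shows "inverse (of_real s + a) = (of_real s - a) /\<^sub>R (s\<^sup>2 + (norm a)\<^sup>2)"
proof -
  have "qcnj (of_real s + a) = of_real s - a" using assms by (simp add: quat_eq_iff)
  moreover have "(norm (of_real s + a))\<^sup>2 = s\<^sup>2 + (norm a)\<^sup>2" unfolding norm_quat_sq using assms by simp
  ultimately show ?thesis by (simp add: inverse_quat_qcnj del: qcnj_simps)
qed

lemma of_real_plus_Im_nonzero: "qRe a = 0 \<Longrightarrow> a \<noteq> 0 \<Longrightarrow> of_real s + a \<noteq> 0"
  by (auto simp: quat_eq_iff)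

lemma left_inv_curve:
  assumes "qRe a = 0"
  shows "k + inverse (of_real s + a) * m = inv_curve k m (- (a * m)) (norm a) s"
proof -
  have "of_real s * m = s *\<^sub>R m" by (simp add: quat_eq_iff)
  then show ?thesis by (simp add: inverse_linear [OF assms] inv_curve_def left_diff_distrib)
qed

lemma right_inv_curve:
  assumes "qRe a = 0"
  shows "k + m * inverse (of_real s + a) = inv_curve k m (- (m * a)) (norm a) s"
proof -
  have "m * of_real s = s *\<^sub>R m" by (simp add: quat_eq_iff)
  then show ?thesis by (simp add: inverse_linear [OF assms] inv_curve_def right_diff_distrib)
qed

lemma inner_Im_mult: "qRe a = 0 \<Longrightarrow> m \<bullet> (a * m) = 0" "qRe a = 0 \<Longrightarrow> m \<bullet> (m * a) = 0"
  by (simp_all add: inner_quat_def algebra_simps)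

subsection \<open>Surfaces with denominators in different variables\<close>

text \<open>For imaginary \<open>p\<close>, \<open>q\<close> the products \<open>p * q\<close> and
  \<open>q * p\<close> share the real part \<open>- (p \<bullet> q)\<close> and have opposite
  imaginary parts, plus and minus the cross product. The hypotheses fix the real part of
  \<open>r\<close> and determine its imaginary part up to this sign.\<close>

lemma eq_prod_or_eq_prod_reversed:
  fixes p q r :: quat
  assumes "qRe p = 0" "qRe q = 0" "qRe r = - (p \<bullet> q)" "p \<bullet> r = 0" "q \<bullet> r = 0"
    "(norm r)\<^sup>2 = (norm p)\<^sup>2 * (norm q)\<^sup>2"
  shows "r = p * q \<or> r = q * p"
proof -
  define n where "n = p * q - q * p"
  have n: "n \<bullet> n = 4 * ((p \<bullet> p) * (q \<bullet> q) - (p \<bullet> q)\<^sup>2)"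
    using assms(1,2) unfolding n_def inner_quat_def quat_times_sel quat_add_group_sel by algebra
  define \<rho> where "\<rho> = r - of_real (qRe r)"
  have "\<rho> \<bullet> \<rho> = r \<bullet> r - (qRe r)\<^sup>2"
    unfolding \<rho>_def inner_quat_def by (simp add: power2_eq_square)
  then have \<rho>: "\<rho> \<bullet> \<rho> = (p \<bullet> p) * (q \<bullet> q) - (p \<bullet> q)\<^sup>2"
    using assms(3,6) unfolding power2_norm_eq_inner by simp
  have \<rho>_perp: "qRe \<rho> = 0" "p \<bullet> \<rho> = 0" "q \<bullet> \<rho> = 0"
    using assms(1,2,4,5) unfolding \<rho>_def inner_quat_def by simp_all
  \<comment> \<open>Both vectors are imaginary and orthogonal to \<open>p\<close> and
    \<open>q\<close>, so the Cauchy-Schwarz inequality is an equality.\<close>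
  have "(n \<bullet> n) * (\<rho> \<bullet> \<rho>) = (n \<bullet> \<rho>)\<^sup>2"
    using assms(1,2) \<rho>_perp unfolding n_def inner_quat_def quat_times_sel quat_add_group_sel by algebra
  moreover have n: "n \<bullet> n = 4 * (\<rho> \<bullet> \<rho>)" using n \<rho> by simp
  ultimately have "(n \<bullet> \<rho>)\<^sup>2 = (2 * (\<rho> \<bullet> \<rho>))\<^sup>2" by (simp add: power2_eq_square)
  then have "n \<bullet> \<rho> = 2 * (\<rho> \<bullet> \<rho>) \<or> n \<bullet> \<rho> = - (2 * (\<rho> \<bullet> \<rho>))" by (simp only: power2_eq_iff)
  then have "(n - 2 *\<^sub>R \<rho>) \<bullet> (n - 2 *\<^sub>R \<rho>) = 0 \<or> (n + 2 *\<^sub>R \<rho>) \<bullet> (n + 2 *\<^sub>R \<rho>) = 0"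
    using n by (auto simp: inner_diff_left inner_diff_right inner_add_left inner_add_right inner_commute)
  then have "n = 2 *\<^sub>R \<rho> \<or> n = - (2 *\<^sub>R \<rho>)" by (auto simp: eq_neg_iff_add_eq_0)
  then show ?thesis
    using assms(1-3) unfolding n_def \<rho>_def by (auto simp: quat_eq_iff inner_quat_def algebra_simps)
qed

text \<open>The quadratic equation for \<open>y\<close> when
  \<open>(s + a) * y * (t + c) = (t + p) * (s + q)\<close>. Its linear and constant parts are such
  that, once denominators are cleared, all monomials in \<open>s\<close> and \<open>t\<close>
  cancel.\<close>

definition mixed_form :: "quat \<Rightarrow> quat \<Rightarrow> quat \<Rightarrow> quat \<Rightarrow> quat \<Rightarrow> real" where
  "mixed_form a c p q y = y \<bullet> (a * y * c) - qRe ((c * a + p * a + c * q + q * p) * y)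
     + (a \<bullet> c - (a + q) \<bullet> (c + p))"

section \<open>Verification of the quadratic equation for the reversed product\<close>

context
  fixes a c p q M :: quat and n :: real
  assumes Re: "qRe a = 0" "qRe c = 0" "qRe p = 0" "qRe q = 0"
  defines "M \<equiv> c * a + p * a + c * q + q * p" and "n \<equiv> a \<bullet> c - (a + q) \<bullet> (c + p)"
begin

lemmas mixed_expand = M_def n_def inner_quat_def quat_times_sel quat_add_group_sel quat_one_sel Re
  mult_zero_left mult_zero_right add_0_left add_0_right diff_0_right diff_0 mult_1_left

text \<open>In this order, the coefficients of \<open>s\<^sup>2 * t\<^sup>2\<close>,
  \<open>s\<^sup>2 * t\<close>, \<open>s * t\<^sup>2\<close>, \<open>s\<close> and \<open>t\<close>
  in the expansion of \<open>mixed_form_eq_0\<close>.\<close>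

lemma mixed_form_coeffs:
  "1 \<bullet> (a * c) - qRe M + n = 0"
  "2 * (1 \<bullet> (a * p * c)) - qRe (M * (p - c)) = 0"
  "2 * (1 \<bullet> (a * q * c)) - qRe (M * (q - a)) = 0"
  "2 * (p \<bullet> (a * (p * q) * c)) - qRe (M * (a * p * c - p * q * c)) = 0"
  "2 * (q \<bullet> (a * (p * q) * c)) - qRe (M * (a * q * c - a * p * q)) = 0"
  unfolding mixed_expand by algebra+

text \<open>The remaining coefficients, of \<open>s\<^sup>2\<close>, \<open>t\<^sup>2\<close>,
  \<open>s * t\<close> and 1; their vanishing uses the equality of norms.\<close>

lemma mixed_form_coeffs_norm:
  assumes norms: "q \<bullet> q = a \<bullet> a" "p \<bullet> p = c \<bullet> c"
  shows "p \<bullet> (a * p * c) + qRe (M * (p * c)) + n * (c \<bullet> c) = 0"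
    "q \<bullet> (a * q * c) + qRe (M * (a * q)) + n * (a \<bullet> a) = 0"
    "2 * (1 \<bullet> (a * (p * q) * c)) + 2 * (p \<bullet> (a * q * c)) - qRe (M * (p * q - a * p - q * c + a * c)) = 0"
    "(p * q) \<bullet> (a * (p * q) * c) - qRe (M * (a * p * q * c)) + n * (a \<bullet> a) * (c \<bullet> c) = 0"
proof -
  show "p \<bullet> (a * p * c) + qRe (M * (p * c)) + n * (c \<bullet> c) = 0"
    using norms unfolding mixed_expand by algebra
  show "q \<bullet> (a * q * c) + qRe (M * (a * q)) + n * (a \<bullet> a) = 0"
    using norms unfolding mixed_expand by algebra
  show "2 * (1 \<bullet> (a * (p * q) * c)) + 2 * (p \<bullet> (a * q * c)) - qRe (M * (p * q - a * p - q * c + a * c)) = 0"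
    using norms unfolding mixed_expand by algebra
  have "(p * q) \<bullet> (a * (p * q) * c) - qRe (M * (a * p * q * c)) =
    (a \<bullet> a) * (c \<bullet> c) * (p \<bullet> q) + (a \<bullet> a) * (p \<bullet> p) * (q \<bullet> c) + (c \<bullet> c) * (q \<bullet> q) * (a \<bullet> p)"
    unfolding mixed_expand by algebra
  then show "(p * q) \<bullet> (a * (p * q) * c) - qRe (M * (a * p * q * c)) + n * (a \<bullet> a) * (c \<bullet> c) = 0"
    unfolding norms n_def inner_add_left inner_add_right by (simp add: inner_commute algebra_simps)
qed

text \<open>
  Multiplied by \<open>|s + a|\<^sup>2 |t + c|\<^sup>2\<close>, the form becomes a polynomial in \<open>s\<close>, \<open>t\<close> with the coefficients
  computed above.
\<close>

lemma mixed_form_eq_0: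
  assumes norms: "q \<bullet> q = a \<bullet> a" "p \<bullet> p = c \<bullet> c" and nz: "a \<noteq> 0" "c \<noteq> 0"
    and y: "(of_real s + a) * y * (of_real t + c) = (of_real t + p) * (of_real s + q)"
  shows "mixed_form a c p q y = 0"
proof -
  define Y where "Y = (of_real t + p) * (of_real s + q)"
  define N where "N = (s\<^sup>2 + a \<bullet> a) * (t\<^sup>2 + c \<bullet> c)"
  have Ns: "(norm (of_real s + a))\<^sup>2 = s\<^sup>2 + a \<bullet> a" "(norm (of_real t + c))\<^sup>2 = t\<^sup>2 + c \<bullet> c"
    unfolding norm_quat_sq inner_quat_def using Re by (simp_all add: power2_eq_square)
  have cj: "qcnj (of_real s + a) = of_real s - a" "qcnj (of_real t + c) = of_real t - c"
    using Re by (simp_all add: quat_eq_iff)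
  have Npos: "N \<noteq> 0" using nz by (simp add: N_def add_nonneg_pos add_nonneg_eq_0_iff)
  have "(of_real s - a) * Y * (of_real t - c)
    = (qcnj (of_real s + a) * (of_real s + a)) * y * ((of_real t + c) * qcnj (of_real t + c))"
    unfolding Y_def y [symmetric] cj by (simp only: mult.assoc)
  also have "\<dots> = N *\<^sub>R y"
    unfolding mult_qcnj Ns N_def by simp
  finally have Ny: "N *\<^sub>R y = (of_real s - a) * Y * (of_real t - c)" ..
  \<comment> \<open>Since \<open>a\<close> commutes with \<open>s + a\<close> and \<open>c\<close>
    with \<open>t + c\<close>, both linear factors can be taken out of the inner product, where they
    contribute the factor \<open>N\<close>.\<close>
  have comm: "a * (of_real s + a) = (of_real s + a) * a" "(of_real t + c) * c = c * (of_real t + c)"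
    by (simp_all add: quat_eq_iff)
  have "Y \<bullet> (a * Y * c) = ((of_real s + a) * (y * (of_real t + c))) \<bullet> ((of_real s + a) * (a * y * c * (of_real t + c)))"
    unfolding Y_def y [symmetric] by (metis comm mult.assoc)
  also have "\<dots> = N * (y \<bullet> (a * y * c))"
    unfolding inner_mult_left inner_mult_right Ns N_def by simp
  finally have Nh: "N * (y \<bullet> (a * y * c)) = Y \<bullet> (a * Y * c)" ..
  have "N * mixed_form a c p q y = N * (y \<bullet> (a * y * c)) - qRe (M * (N *\<^sub>R y)) + n * N"
    unfolding mixed_form_def M_def n_def by (simp add: algebra_simps)
  also have "\<dots> = Y \<bullet> (a * Y * c) - qRe (M * ((of_real s - a) * Y * (of_real t - c))) + n * N"
    unfolding Nh Ny ..
  also have "\<dots> = 0"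
  proof -
    \<comment> \<open>A symmetric bilinear form: both \<open>a\<close> and \<open>c\<close> are
      imaginary, so the two signs in the adjoint of \<open>z -> a * z * c\<close> cancel.\<close>
    define h where "h x z = x \<bullet> (a * z * c)" for x z
    have hsym: "h z x = h x z" for x z
      unfolding h_def inner_quat_def quat_times_sel Re by algebra
    have hl: "h (x + x') z = h x z + h x' z" "h z (x + x') = h z x + h z x'"
      "h (r *\<^sub>R x) z = r * h x z" "h z (r *\<^sub>R x) = r * h z x" for x x' z r
      by (simp_all add: h_def algebra_simps)
    have Y: "Y = bil (p * q) p q 1 s t"
      unfolding Y_def bil_def by (simp add: quat_eq_iff algebra_simps)
    have hY: "Y \<bullet> (a * Y * c) = (s * t)\<^sup>2 * h 1 1 + s\<^sup>2 * t * (2 * h 1 p) + s * t\<^sup>2 * (2 * h 1 q)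
      + s\<^sup>2 * h p p + t\<^sup>2 * h q q + s * t * (2 * h 1 (p * q) + 2 * h p q)
      + s * (2 * h p (p * q)) + t * (2 * h q (p * q)) + h (p * q) (p * q)"
      unfolding h_def [symmetric] Y bil_def hl
      by (simp add: hsym [of 1 p] hsym [of 1 q] hsym [of 1 "p * q"] hsym [of p q] hsym [of p "p * q"]
          hsym [of q "p * q"] power2_eq_square algebra_simps)
    have "(of_real s - a) * Y * (of_real t - c) = (s * t)\<^sup>2 *\<^sub>R 1 + (s\<^sup>2 * t) *\<^sub>R (p - c) + (s * t\<^sup>2) *\<^sub>R (q - a)
      - s\<^sup>2 *\<^sub>R (p * c) - t\<^sup>2 *\<^sub>R (a * q) + (s * t) *\<^sub>R (p * q - a * p - q * c + a * c)
      + s *\<^sub>R (a * p * c - p * q * c) + t *\<^sub>R (a * q * c - a * p * q) + a * p * q * c"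
      unfolding Y bil_def of_real_def by (simp add: algebra_simps power2_eq_square)
    then have MY: "qRe (M * ((of_real s - a) * Y * (of_real t - c))) = (s * t)\<^sup>2 * qRe M
      + s\<^sup>2 * t * qRe (M * (p - c)) + s * t\<^sup>2 * qRe (M * (q - a)) - s\<^sup>2 * qRe (M * (p * c))
      - t\<^sup>2 * qRe (M * (a * q)) + s * t * qRe (M * (p * q - a * p - q * c + a * c))
      + s * qRe (M * (a * p * c - p * q * c)) + t * qRe (M * (a * q * c - a * p * q)) + qRe (M * (a * p * q * c))"
      by (simp only: distrib_left right_diff_distrib mult_scaleR_right mult_1_right quat_add_group_sel quat_scaleR_sel)
    have "Y \<bullet> (a * Y * c) - qRe (M * ((of_real s - a) * Y * (of_real t - c))) + n * N =
        (s * t)\<^sup>2 * (h 1 1 - qRe M + n)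
      + s\<^sup>2 * t * (2 * h 1 p - qRe (M * (p - c))) + s * t\<^sup>2 * (2 * h 1 q - qRe (M * (q - a)))
      + s\<^sup>2 * (h p p + qRe (M * (p * c)) + n * (c \<bullet> c)) + t\<^sup>2 * (h q q + qRe (M * (a * q)) + n * (a \<bullet> a))
      + s * t * (2 * h 1 (p * q) + 2 * h p q - qRe (M * (p * q - a * p - q * c + a * c)))
      + s * (2 * h p (p * q) - qRe (M * (a * p * c - p * q * c)))
      + t * (2 * h q (p * q) - qRe (M * (a * q * c - a * p * q)))
      + (h (p * q) (p * q) - qRe (M * (a * p * q * c)) + n * (a \<bullet> a) * (c \<bullet> c))"
      unfolding hY MY N_def by algebra
    also have "\<dots> = 0"
      unfolding h_def mult_1_right mixed_form_coeffs mixed_form_coeffs_norm [OF norms] by simp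
    finally show ?thesis .
  qed
  finally show ?thesis using Npos by simp
qed

end

lemma quadfun_mixed_form: "quadfun (\<lambda>x. mixed_form a c p q (k * x))"
  unfolding mixed_form_def
  by (intro quadfun_add quadfun_diff quadfun_inner quadfun_affine affine_map_sel(1) affine_map_intros affine_fun_const)

text \<open>If the form vanished on \<open>S3\<close>, adding its values at \<open>y\<close> and
  \<open>- y\<close> would remove the linear part and make \<open>y \<bullet> (a * y * c)\<close>
  constant there. The constant is 0, so by polarisation \<open>a * z * c = 0\<close> for all
  \<open>z\<close>, which is impossible.\<close>

lemma mixed_form_nontrivial:
  assumes "qRe a = 0" "qRe c = 0" "a \<noteq> 0" "c \<noteq> 0"
  shows "\<exists>y\<in>S3. mixed_form a c p q y \<noteq> 0"
proof (rule ccontr)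
  define n where "n = a \<bullet> c - (a + q) \<bullet> (c + p)"
  assume "\<not> ?thesis"
  then have 0: "mixed_form a c p q y = 0" if "y \<in> S3" for y using that by blast
  have unit: "y \<bullet> (a * y * c) = - n" if "y \<in> S3" for y
  proof -
    have "- y \<in> S3" using that by (simp add: S3_def)
    then have "mixed_form a c p q y + mixed_form a c p q (- y) = 0" using 0 that by simp
    then show ?thesis unfolding mixed_form_def n_def by simp
  qed
  have "Quat 1 0 0 0 \<in> S3" "Quat 0 1 0 0 \<in> S3" "Quat 0 0 1 0 \<in> S3" "Quat 0 0 0 1 \<in> S3"
    by (simp_all add: S3_def norm_quat_def inner_quat_def)
  \<comment> \<open>The four values add up to the trace of \<open>y -> a * y * c\<close>, which is
    \<open>4 * qRe a * qRe c = 0\<close>.\<close>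
  from this [THEN unit] have n: "n = 0"
    using assms(1,2) by (simp add: inner_quat_def)
  have all: "y \<bullet> (a * y * c) = 0" for y
  proof (cases "y = 0")
    case False
    then have "y /\<^sub>R norm y \<in> S3" by (simp add: S3_def)
    from unit [OF this] show ?thesis using n False by simp
  qed simp
  have "x \<bullet> (a * z * c) = 0" for x z
  proof -
    have "x \<bullet> (a * z * c) = z \<bullet> (a * x * c)"
      unfolding inner_quat_def quat_times_sel assms(1,2) by algebra
    then show ?thesis
      using all [of "x + z"] all [of x] all [of z]
      by (simp add: inner_add_left inner_add_right distrib_left distrib_right)
  qed
  from this [of "a * 1 * c" 1] show False using assms(3,4) by simp
qed

text \<open>The three products express that \<open>e\<close> is orthogonal to \<open>a\<close>, to
  \<open>c\<close> and to their cross product. These span the imaginary quaternions because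
  \<open>a\<close> and \<open>c\<close> do not commute.\<close>

lemma perp_commutator_eq_0:
  fixes a c e :: quat
  assumes "qRe a = 0" "qRe c = 0" "qRe e = 0" "qRe (a * e) = 0" "qRe (e * c) = 0" "qRe (a * e * c) = 0"
    and "a * c \<noteq> c * a"
  shows "e = 0"
proof -
  define n where "n = a * c - c * a"
  have n: "n \<bullet> n \<noteq> 0" using assms(7) by (simp add: n_def)
  have "(n \<bullet> n) * qI e = 0" "(n \<bullet> n) * qJ e = 0" "(n \<bullet> n) * qK e = 0"
    using assms(1-6) unfolding n_def inner_quat_def quat_times_sel quat_add_group_sel by algebra+
  then have "qI e = 0" "qJ e = 0" "qK e = 0" using n by simp_all
  then show ?thesis using assms(3) by (simp add: quat_eq_iff)
qed

lemma commuting_Im_parallel: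
  fixes a c :: quat
  assumes "qRe a = 0" "qRe c = 0" "a \<noteq> 0" "a * c = c * a"
  obtains l where "c = l *\<^sub>R a"
proof -
  have "a \<bullet> a \<noteq> 0" using assms(3) by simp
  moreover have "(a \<bullet> a) *\<^sub>R c = (a \<bullet> c) *\<^sub>R a"
    using assms(1,2,4) unfolding quat_eq_iff inner_quat_def by (simp; intro conjI; algebra)
  ultimately have "c = ((a \<bullet> c) / (a \<bullet> a)) *\<^sub>R a"
    by (metis divideR_right scaleR_scaleR divide_inverse_commute)
  then show ?thesis by (rule that)
qed

lemma plane_darboux:
  assumes "qRe a = 0" "a \<noteq> 0"
  shows "darboux_cyclide {x \<in> ImH. a \<bullet> x = r}"
proof -
  have nz: "\<exists>i\<in>{1..3}. qcoord a i \<noteq> 0"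
  proof -
    have "qcoord a 1 = qI a" "qcoord a 2 = qJ a" "qcoord a 3 = qK a"
      by (simp_all add: qcoord_def eval_nat_numeral)
    moreover have "qI a \<noteq> 0 \<or> qJ a \<noteq> 0 \<or> qK a \<noteq> 0" using assms by (auto simp: quat_eq_iff)
    ultimately show ?thesis
      by (metis atLeastAtMost_iff le_numeral_extra(4) numeral_le_iff one_le_numeral order_refl
          semiring_norm(69) semiring_norm(72) numeral_One)
  qed
  have "{x \<in> ImH. a \<bullet> x = r} = {q \<in> ImH. let x = qI q; y = qJ q; z = qK q in
      0 * (x\<^sup>2 + y\<^sup>2 + z\<^sup>2)\<^sup>2 + (x\<^sup>2 + y\<^sup>2 + z\<^sup>2) * (0 * x + 0 * y + 0 * z)
      + quad_poly {1..3} (\<lambda>i j. 0) (qcoord a) (- r) (qcoord q) = 0}"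
    unfolding quad_poly_explicit_Im Let_def
    by (auto simp: qcoord_def eval_nat_numeral inner_quat_def ImH_def)
  then show ?thesis
    unfolding darboux_cyclide_def using nz by blast
qed

text \<open>A noncommutative partial fraction decomposition of \<phi>, followed by comparing
  coefficients in the vanishing of its real part. If \<open>a\<close> and \<open>c\<close> do not
  commute, the mixed term disappears and \<phi> is a sum of two circular curves; if they are
  parallel, \<phi> moves in a plane orthogonal to \<open>a\<close>.\<close>

lemma middle_ImH:
  assumes grid: "param_grid s t D"
    and a: "qRe a = 0" "a \<noteq> 0" and c: "qRe c = 0" "c \<noteq> 0"
    and eq: "\<forall>w\<in>D. (of_real (s w) + a) * \<phi> w * (of_real (t w) + c) = bil b0 b1 b2 b3 (s w) (t w)"
    and Im: "\<phi> ` D \<subseteq> ImH"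
  shows "\<exists>S. (euclidean_translational S \<or> darboux_cyclide S) \<and> \<phi> ` D \<subseteq> S"
proof -
  \<comment> \<open>Division of the numerator by \<open>s + a\<close> on the left and by
    \<open>t + c\<close> on the right, with remainders \<open>m\<close>, \<open>m'\<close> and
    \<open>e\<close>.\<close>
  define m where "m = b2 - a * b3"
  define m' where "m' = b1 - b3 * c"
  define e where "e = b0 - b2 * c - a * b1 + a * b3 * c"
  have pos: "s\<^sup>2 + (norm a)\<^sup>2 \<noteq> 0" "s\<^sup>2 + (norm c)\<^sup>2 \<noteq> 0" for s :: real
    using a(2) c(2) by (simp_all add: add_nonneg_eq_0_iff)
  have dec: "\<phi> w = b3 + inverse (of_real (s w) + a) * m + m' * inverse (of_real (t w) + c)
      + inverse (of_real (s w) + a) * e * inverse (of_real (t w) + c)" if w: "w \<in> D" for w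
  proof -
    define P where "P = of_real (s w) + a"
    define R where "R = of_real (t w) + c"
    have nz: "P \<noteq> 0" "R \<noteq> 0" unfolding P_def R_def using a c of_real_plus_Im_nonzero by auto
    have "bil b0 b1 b2 b3 (s w) (t w) = P * b3 * R + m * R + P * m' + e"
      unfolding P_def R_def m_def m'_def e_def bil_def of_real_def by (simp add: algebra_simps)
    then have "P * \<phi> w * R = P * b3 * R + m * R + P * m' + e"
      using eq w by (simp add: P_def R_def)
    then have "inverse P * (P * \<phi> w * R) * inverse R = inverse P * (P * b3 * R + m * R + P * m' + e) * inverse R"
      by simp
    moreover have "inverse P * (P * x) = x" "x * R * inverse R = x" for x
      using nz by (simp_all add: mult.assoc [symmetric]) (simp add: mult.assoc)
    ultimately have "\<phi> w = b3 + inverse P * m + m' * inverse R + inverse P * e * inverse R"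
      by (simp add: distrib_left distrib_right mult.assoc [symmetric]) (simp add: mult.assoc nz)
    then show ?thesis by (simp add: P_def R_def)
  qed
  \<comment> \<open>The real part of \<phi>, multiplied by both squared norms of the denominators
    and sorted by powers of \<open>s w\<close> and \<open>t w\<close>.\<close>
  have "((norm a)\<^sup>2 * (norm c)\<^sup>2 * qRe b3 - (norm c)\<^sup>2 * qRe (a * m) - (norm a)\<^sup>2 * qRe (m' * c) + qRe (a * e * c)
      + ((norm c)\<^sup>2 * qRe m - qRe (e * c)) * s w + ((norm c)\<^sup>2 * qRe b3 - qRe (m' * c)) * (s w)\<^sup>2)
    + ((norm a)\<^sup>2 * qRe m' - qRe (a * e) + qRe e * s w + qRe m' * (s w)\<^sup>2) * t w
    + ((norm a)\<^sup>2 * qRe b3 - qRe (a * m) + qRe m * s w + qRe b3 * (s w)\<^sup>2) * (t w)\<^sup>2 = 0"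
    if w: "w \<in> D" for w
  proof -
    define N1 where "N1 = (s w)\<^sup>2 + (norm a)\<^sup>2"
    define N2 where "N2 = (t w)\<^sup>2 + (norm c)\<^sup>2"
    have N: "N1 \<noteq> 0" "N2 \<noteq> 0" using pos by (simp_all add: N1_def N2_def)
    have inv: "N1 * N2 * inverse N1 = N2" "N1 * N2 * inverse N2 = N1" "N1 * N2 * (inverse N2 * inverse N1) = 1"
      using N by (simp_all add: field_simps)
    have "0 = N1 * N2 * qRe (\<phi> w)" using Im w by (auto simp: ImH_def)
    also have "\<dots> = qRe ((N1 * N2) *\<^sub>R b3 + N2 *\<^sub>R ((of_real (s w) - a) * m) + N1 *\<^sub>R (m' * (of_real (t w) - c))
      + (of_real (s w) - a) * e * (of_real (t w) - c))"
      unfolding dec [OF w] inverse_linear [OF a(1)] inverse_linear [OF c(1)] N1_def [symmetric] N2_def [symmetric]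
        quat_scaleR_sel(1) [symmetric]
      by (simp add: scaleR_add_right inv del: quat_times_sel)
    also have "\<dots> = N1 * N2 * qRe b3 + N2 * (s w * qRe m - qRe (a * m)) + N1 * (t w * qRe m' - qRe (m' * c))
      + s w * t w * qRe e - s w * qRe (e * c) - t w * qRe (a * e) + qRe (a * e * c)"
      unfolding of_real_def
      by (simp only: left_diff_distrib right_diff_distrib mult_scaleR_left mult_scaleR_right mult_1_left mult_1_right
          quat_add_group_sel quat_scaleR_sel scaleR_diff_right scaleR_scaleR) (simp only: algebra_simps)
    finally show ?thesis unfolding N1_def N2_def by algebra
  qed
  note coeffs = grid_coeffs_zero [OF grid this]
  have Re: "qRe b3 = 0" "qRe m = 0" "qRe m' = 0" "qRe e = 0"
    using coeffs(5-9) by (simp_all del: quat_times_sel)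
  have Re': "qRe (a * m) = 0" "qRe (m' * c) = 0" "qRe (e * c) = 0" "qRe (a * e) = 0"
    using coeffs(2-4,7) Re by (simp_all del: quat_times_sel)
  have Re'': "qRe (a * e * c) = 0"
    using coeffs(1) Re Re' by (simp del: quat_times_sel)
  show ?thesis
  proof (cases "a * c = c * a")
    case False
    have e: "e = 0"
      by (rule perp_commutator_eq_0 [OF a(1) c(1) Re(4) Re'(4) Re'(3) Re'' False])
    have "\<exists>\<alpha>. is_circle \<alpha> \<and> \<alpha> \<subseteq> ImH \<and> (\<forall>s. inv_curve b3 m (- (a * m)) (norm a) s \<in> \<alpha>)"
      using a Re Re'
      by (intro inv_curve_in_circle_ImH) (auto simp: inner_Im_mult norm_mult ImH_def simp del: quat_times_sel)
    then obtain \<alpha> where \<alpha>: "is_circle \<alpha>" "\<alpha> \<subseteq> ImH" "\<And>s. inv_curve b3 m (- (a * m)) (norm a) s \<in> \<alpha>" by blast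
    have "\<exists>\<beta>. is_circle \<beta> \<and> \<beta> \<subseteq> ImH \<and> (\<forall>s. inv_curve 0 m' (- (m' * c)) (norm c) s \<in> \<beta>)"
      using c Re Re'
      by (intro inv_curve_in_circle_ImH) (auto simp: inner_Im_mult norm_mult ImH_def simp del: quat_times_sel)
    then obtain \<beta> where \<beta>: "is_circle \<beta>" "\<beta> \<subseteq> ImH" "\<And>s. inv_curve 0 m' (- (m' * c)) (norm c) s \<in> \<beta>" by blast
    have "\<phi> w \<in> {p + q |p q. p \<in> \<alpha> \<and> q \<in> \<beta>}" if "w \<in> D" for w
    proof -
      have "\<phi> w = (b3 + inverse (of_real (s w) + a) * m) + (0 + m' * inverse (of_real (t w) + c))"
        using dec [OF that] e by simp
      then show ?thesis
        unfolding left_inv_curve [OF a(1)] right_inv_curve [OF c(1)] using \<alpha>(3) \<beta>(3) by blast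
    qed
    moreover have "euclidean_translational {p + q |p q. p \<in> \<alpha> \<and> q \<in> \<beta>}"
      unfolding euclidean_translational_def using \<alpha>(1,2) \<beta>(1,2) by blast
    ultimately show ?thesis by blast
  next
    case True
    then obtain l where l: "c = l *\<^sub>R a" using commuting_Im_parallel [OF a(1) c(1) a(2)] by blast
    have l0: "l \<noteq> 0" using c(2) l by auto
    \<comment> \<open>As \<open>c\<close> is a nonzero real multiple of \<open>a\<close>, the
      conditions on \<open>a * x\<close> and on \<open>x * c\<close> are equivalent. They make every
      nonconstant term of the decomposition orthogonal to \<open>a\<close>.\<close>
    have perp: "a \<bullet> x = 0" "a \<bullet> (a * x) = 0" "a \<bullet> (x * c) = 0" if "qRe x = 0" "qRe (a * x) = 0 \<or> qRe (x * c) = 0" for x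
    proof -
      have "qRe (x * c) = l * qRe (a * x)" unfolding l by simp
      then have ax: "qRe (a * x) = 0" using that(2) l0 by (simp del: quat_times_sel)
      then show "a \<bullet> x = 0" using a(1) by (simp add: inner_quat_def)
      show "a \<bullet> (a * x) = 0" using inner_mult_left [of a 1 x] that(1) by (simp add: inner_quat_def)
      have "a \<bullet> (x * a) = 0" using inner_mult_right [of 1 a x] that(1) by (simp add: inner_quat_def)
      then show "a \<bullet> (x * c) = 0" unfolding l by simp
    qed
    have "a \<bullet> (a * e * c) = 0"
      using inner_mult_left [of a 1 "e * c"] Re'(3) by (simp add: mult.assoc inner_quat_Re del: quat_times_sel)
    note perps = this perp [OF Re(2)] perp [OF Re(3)] perp [OF Re(4)]
    have of_real_mult: "of_real r * x = r *\<^sub>R x" "x * of_real r = r *\<^sub>R x" for r and x :: quat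
      by (simp_all add: quat_eq_iff)
    have "a \<bullet> \<phi> w = a \<bullet> b3" if "w \<in> D" for w
      unfolding dec [OF that] inverse_linear [OF a(1)] inverse_linear [OF c(1)]
      using perps Re' by (simp add: inner_add_right inner_diff_right left_diff_distrib right_diff_distrib of_real_mult
          del: quat_times_sel)
    then have "\<phi> ` D \<subseteq> {x \<in> ImH. a \<bullet> x = a \<bullet> b3}" using Im by auto
    then show ?thesis using plane_darboux [OF a] by blast
  qed
qed

text \<open>Comparing the squared norms of both sides shows that \<open>b3\<close> is a unit and,
  after division by it, that the other coefficients satisfy the hypotheses of
  \<open>eq_prod_or_eq_prod_reversed\<close>. The order of the two factors decides between the
  quadric and the Clifford translational surface.\<close>

lemma middle_S3:
  assumes grid: "param_grid s t D"
    and a: "qRe a = 0" "a \<noteq> 0" and c: "qRe c = 0" "c \<noteq> 0"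
    and eq: "\<forall>w\<in>D. (of_real (s w) + a) * \<phi> w * (of_real (t w) + c) = bil b0 b1 b2 b3 (s w) (t w)"
    and S3: "\<phi> ` D \<subseteq> S3"
  shows "(\<exists>S. clifford_translational S \<and> \<phi> ` D \<subseteq> S) \<or> on_quadric (\<phi> ` D)"
proof -
  have Ns: "(norm (of_real s + x))\<^sup>2 = s\<^sup>2 + (norm x)\<^sup>2" if "qRe x = 0" for x s
    unfolding norm_quat_sq using that by simp
  have "((norm b0)\<^sup>2 - (norm a)\<^sup>2 * (norm c)\<^sup>2 + 2 * (b0 \<bullet> b1) * s w + ((norm b1)\<^sup>2 - (norm c)\<^sup>2) * (s w)\<^sup>2)
     + (2 * (b0 \<bullet> b2) + 2 * (b0 \<bullet> b3 + b1 \<bullet> b2) * s w + 2 * (b1 \<bullet> b3) * (s w)\<^sup>2) * t w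
     + ((norm b2)\<^sup>2 - (norm a)\<^sup>2 + 2 * (b2 \<bullet> b3) * s w + ((norm b3)\<^sup>2 - 1) * (s w)\<^sup>2) * (t w)\<^sup>2 = 0"
    if w: "w \<in> D" for w
  proof -
    have "norm (\<phi> w) = 1" using S3 w by (auto simp: S3_def)
    then have "(norm (bil b0 b1 b2 b3 (s w) (t w)))\<^sup>2 = ((s w)\<^sup>2 + (norm a)\<^sup>2) * ((t w)\<^sup>2 + (norm c)\<^sup>2)"
      using eq [rule_format, OF w, symmetric] by (simp add: norm_mult power_mult_distrib Ns a c)
    then show ?thesis unfolding norm_bil by (simp add: algebra_simps)
  qed
  note coeffs = grid_coeffs_zero [OF grid this]
  have b3: "norm b3 = 1"
    using coeffs(9) power2_eq_iff_nonneg [of "norm b3" 1] by simp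
  have b: "(norm b0)\<^sup>2 = (norm a)\<^sup>2 * (norm c)\<^sup>2" "(norm b1)\<^sup>2 = (norm c)\<^sup>2" "(norm b2)\<^sup>2 = (norm a)\<^sup>2"
    "b1 \<bullet> b0 = 0" "b2 \<bullet> b0 = 0" "b3 \<bullet> b1 = 0" "b3 \<bullet> b2 = 0" "b3 \<bullet> b0 = - (b1 \<bullet> b2)"
    using coeffs by (simp_all add: inner_commute)
  define p where "p = qcnj b3 * b1"
  define q where "q = qcnj b3 * b2"
  define r where "r = qcnj b3 * b0"
  have Re: "qRe p = 0" "qRe q = 0"
    using b(6,7) by (simp_all add: p_def q_def inner_quat_Re del: quat_times_sel)
  have pq: "norm p = norm c" "norm q = norm a"
    using b(2,3) b3 by (simp_all add: p_def q_def norm_mult)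
  have "r = p * q \<or> r = q * p"
  proof (rule eq_prod_or_eq_prod_reversed [OF Re])
    show "qRe r = - (p \<bullet> q)" "p \<bullet> r = 0" "q \<bullet> r = 0"
      unfolding p_def q_def r_def inner_mult_left using b b3 by (simp_all add: inner_quat_Re del: quat_times_sel)
    show "(norm r)\<^sup>2 = (norm p)\<^sup>2 * (norm q)\<^sup>2"
      unfolding pq r_def using b(1) b3 by (simp add: norm_mult mult.commute)
  qed
  moreover have bil: "bil b0 b1 b2 b3 u v = b3 * bil r p q 1 u v" for u v
    unfolding bil_mult p_def q_def r_def using b3 by (simp add: qcnj_unit_left)
  ultimately consider
    "\<And>u v. bil b0 b1 b2 b3 u v = b3 * ((of_real v + p) * (of_real u + q))" |
    "\<And>u v. bil b0 b1 b2 b3 u v = b3 * ((of_real u + q) * (of_real v + p))"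
  proof (elim disjE, goal_cases)
    case 1
    then have "bil r p q 1 u v = (of_real v + p) * (of_real u + q)" for u v
      unfolding bil_def of_real_def by (simp add: algebra_simps)
    then show ?case using 1 bil by simp
  next
    case 2
    then have "bil r p q 1 u v = (of_real u + q) * (of_real v + p)" for u v
      unfolding bil_def of_real_def by (simp add: algebra_simps)
    then show ?case using 2 bil by simp
  qed
  then show ?thesis
  proof cases
    case 1
    \<comment> \<open>Conjugating \<open>a\<close> by \<open>b3\<close> moves the unit past the left
      denominator: \<open>(s + a) * b3 = b3 * (s + a')\<close>.\<close>
    define a' where "a' = qcnj b3 * a * b3"
    have Rea': "qRe a' = 0"
    proof -
      have "qRe a' = qRe (b3 * (qcnj b3 * a))" unfolding a'_def by (rule qRe_mult_commute)
      then show ?thesis using b3 a(1) by (simp add: qcnj_unit_left)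
    qed
    have na': "norm a' = norm a" using b3 by (simp add: a'_def norm_mult)
    then have a': "a' \<noteq> 0" using a(2) by auto
    have "mixed_form a' c p q (qcnj b3 * \<phi> w) = 0" if w: "w \<in> D" for w
    proof (rule mixed_form_eq_0 [OF Rea' c(1) Re])
      show "q \<bullet> q = a' \<bullet> a'" "p \<bullet> p = c \<bullet> c"
        using pq na' by (simp_all add: power2_norm_eq_inner [symmetric])
      have "(of_real (s w) + a') * (qcnj b3 * \<phi> w) * (of_real (t w) + c)
        = qcnj b3 * ((of_real (s w) + a) * \<phi> w * (of_real (t w) + c))"
        unfolding a'_def of_real_def using b3
        by (simp add: distrib_left distrib_right mult.assoc qcnj_unit_left)
      also have "\<dots> = (of_real (t w) + p) * (of_real (s w) + q)"
        unfolding eq [rule_format, OF w] 1 using b3 by (simp add: qcnj_unit_left)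
      finally show "(of_real (s w) + a') * (qcnj b3 * \<phi> w) * (of_real (t w) + c)
        = (of_real (t w) + p) * (of_real (s w) + q)" .
    qed (use a' c in auto)
    moreover obtain y where "y \<in> S3" "mixed_form a' c p q y \<noteq> 0"
      using mixed_form_nontrivial [OF Rea' c(1) a' c(2)] by blast
    then have "b3 * y \<in> S3" "mixed_form a' c p q (qcnj b3 * (b3 * y)) \<noteq> 0"
      using b3 by (simp_all add: S3_def norm_mult qcnj_unit_left)
    ultimately have "on_quadric (\<phi> ` D)"
      unfolding on_quadric_def
      by (intro exI [of _ "\<lambda>x. mixed_form a' c p q (qcnj b3 * x)"] conjI quadfun_mixed_form) auto
    then show ?thesis ..
  next
    case 2
    have nz: "of_real u + a \<noteq> 0" "of_real u + c \<noteq> 0" for u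
      using a c of_real_plus_Im_nonzero by auto
    have norm_eq: "norm (of_real u + x) = norm (of_real u + z)" if "qRe x = 0" "qRe z = 0" "norm x = norm z" for u x z
      using Ns [OF that(1), of u] Ns [OF that(2), of u] that(3)
      by (metis norm_ge_zero power2_eq_iff_nonneg)
    \<comment> \<open>Here \<phi> is a product of one factor depending on \<open>s\<close> and one
      depending on \<open>t\<close>. Each is a unit because numerator and denominator have equal
      norms; \<open>m\<close> is the remainder of \<open>b3 * (u + q)\<close> modulo
      \<open>u + a\<close>.\<close>
    define m where "m = b3 * q - a * b3"
    have left: "inverse (of_real u + a) * (b3 * (of_real u + q)) = b3 + inverse (of_real u + a) * m" for u
    proof -
      define P where "P = of_real u + a"
      have "b3 * (of_real u + q) = P * b3 + m"
        unfolding P_def m_def of_real_def by (simp add: algebra_simps)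
      moreover have "inverse P * (P * b3) = b3"
        using nz(1) [of u] by (simp add: P_def [symmetric] mult.assoc [symmetric])
      ultimately show ?thesis
        unfolding P_def [symmetric] by (simp only: distrib_left)
    qed
    have right: "(of_real v + p) * inverse (of_real v + c) = 1 + (p - c) * inverse (of_real v + c)" for v
    proof -
      have "of_real v + p = (of_real v + c) + (p - c)" by simp
      then show ?thesis using nz(2) [of v] by (metis distrib_right right_inverse)
    qed
    have "\<exists>\<alpha>. is_circle \<alpha> \<and> \<alpha> \<subseteq> S3 \<and> (\<forall>u. inv_curve b3 m (- (a * m)) (norm a) u \<in> \<alpha>)"
    proof (rule inv_curve_in_circle_S3)
      show "inv_curve b3 m (- (a * m)) (norm a) u \<in> S3" for u
        unfolding left_inv_curve [OF a(1), symmetric] left [symmetric] S3_def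
        using nz(1) [of u] b3 norm_eq [OF Re(2) a(1) pq(2), of u] by (simp add: norm_mult norm_inverse)
    qed (use a b3 in \<open>simp_all add: inner_Im_mult norm_mult S3_def\<close>)
    then obtain \<alpha> where \<alpha>: "is_circle \<alpha>" "\<alpha> \<subseteq> S3" "\<And>u. inv_curve b3 m (- (a * m)) (norm a) u \<in> \<alpha>" by blast
    have "\<exists>\<beta>. is_circle \<beta> \<and> \<beta> \<subseteq> S3 \<and> (\<forall>v. inv_curve 1 (p - c) (- ((p - c) * c)) (norm c) v \<in> \<beta>)"
    proof (rule inv_curve_in_circle_S3)
      show "inv_curve 1 (p - c) (- ((p - c) * c)) (norm c) v \<in> S3" for v
        unfolding right_inv_curve [OF c(1), symmetric] right [symmetric] S3_def
        using nz(2) [of v] norm_eq [OF Re(1) c(1) pq(1), of v] by (simp add: norm_mult norm_inverse)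
    qed (use c in \<open>simp_all add: inner_Im_mult norm_mult S3_def\<close>)
    then obtain \<beta> where \<beta>: "is_circle \<beta>" "\<beta> \<subseteq> S3" "\<And>v. inv_curve 1 (p - c) (- ((p - c) * c)) (norm c) v \<in> \<beta>" by blast
    have "\<phi> w \<in> {x * y |x y. x \<in> \<alpha> \<and> y \<in> \<beta>}" if w: "w \<in> D" for w
    proof -
      define P where "P = of_real (s w) + a"
      define R where "R = of_real (t w) + c"
      have nzPR: "P \<noteq> 0" "R \<noteq> 0" using nz by (simp_all add: P_def R_def)
      have "P * \<phi> w * R = b3 * ((of_real (s w) + q) * (of_real (t w) + p))"
        using eq [rule_format, OF w] 2 by (simp add: P_def R_def)
      then have "inverse P * (P * \<phi> w * R) * inverse R
        = (inverse P * (b3 * (of_real (s w) + q))) * ((of_real (t w) + p) * inverse R)"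
        by (simp only: mult.assoc)
      moreover have "inverse P * (P * \<phi> w * R) * inverse R = \<phi> w"
        using nzPR by (simp add: mult.assoc [symmetric]) (simp add: mult.assoc)
      ultimately have "\<phi> w = inv_curve b3 m (- (a * m)) (norm a) (s w) * inv_curve 1 (p - c) (- ((p - c) * c)) (norm c) (t w)"
        unfolding P_def R_def left right left_inv_curve [OF a(1)] right_inv_curve [OF c(1)] by simp
      then show ?thesis using \<alpha>(3) \<beta>(3) by blast
    qed
    moreover have "clifford_translational {x * y |x y. x \<in> \<alpha> \<and> y \<in> \<beta>}"
      unfolding clifford_translational_def using \<alpha>(1,2) \<beta>(1,2) by blast
    ultimately show ?thesis by blast
  qed
qed

lemma middle_classified:
  assumes "param_grid s t D"
    and "qRe a = 0" "a \<noteq> 0" "qRe c = 0" "c \<noteq> 0"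
    and "\<forall>w\<in>D. (of_real (s w) + a) * \<phi> w * (of_real (t w) + c) = bil b0 b1 b2 b3 (s w) (t w)"
  shows "classified (\<phi> ` D)"
  unfolding classified_def
  using middle_ImH [OF assms] middle_S3 [OF assms] on_quadric_imp_other_quadric by blast

subsection \<open>The four shapes of the denominators\<close>

lemma param_grid_shift:
  assumes "param_grid s t D" shows "param_grid (\<lambda>w. s w + x) (\<lambda>w. t w + y) D"
proof -
  obtain U V where UV: "infinite U" "infinite V" "\<forall>u\<in>U. \<forall>v\<in>V. \<exists>w\<in>D. s w = u \<and> t w = v"
    using assms unfolding param_grid_def by blast
  have "infinite ((\<lambda>u. u + x) ` U)" "infinite ((\<lambda>v. v + y) ` V)"
    using UV by (simp_all add: finite_image_iff inj_on_def)
  moreover have "\<forall>u\<in>(\<lambda>u. u + x) ` U. \<forall>v\<in>(\<lambda>v. v + y) ` V. \<exists>w\<in>D. s w + x = u \<and> t w + y = v"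
    using UV(3) by auto
  ultimately show ?thesis unfolding param_grid_def by blast
qed

lemma open_imp_param_grid:
  assumes "open D" "D \<noteq> {}"
  shows "param_grid fst snd D" "param_grid snd fst D"
proof -
  obtain A B where AB: "open A" "open B" "A \<noteq> {}" "B \<noteq> {}" "A \<times> B \<subseteq> D"
    using assms by (metis all_not_in_conv open_prod_elim mem_Times_iff)
  then have inf: "infinite A" "infinite B"
    using finite_imp_not_open by blast+
  have AB': "\<And>u v. u \<in> A \<Longrightarrow> v \<in> B \<Longrightarrow> (u, v) \<in> D" using AB(5) by auto
  show "param_grid fst snd D" unfolding param_grid_def using inf AB' by (metis fst_conv snd_conv)
  show "param_grid snd fst D" unfolding param_grid_def using inf AB' by (metis fst_conv snd_conv)
qed

lemma bil_shift:
  "bil b0 b1 b2 b3 u v =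
     bil (b0 - x *\<^sub>R b1 - y *\<^sub>R b2 + (x * y) *\<^sub>R b3) (b1 - y *\<^sub>R b3) (b2 - x *\<^sub>R b3) b3 (u + x) (v + y)"
  by (simp add: bil_def algebra_simps)

text \<open>A left denominator that is a real polynomial times a constant \<open>k\<close> can be
  moved to the right: the constant is absorbed into the numerator, and the real polynomial is
  central and joins the other denominator.\<close>

lemma real_multiple_left_classified:
  assumes grid: "param_grid s t D"
    and nz: "\<forall>w\<in>D. a0 + s w *\<^sub>R a1 \<noteq> 0 \<and> c0 + t w *\<^sub>R c1 \<noteq> 0"
    and eq: "\<forall>w\<in>D. (a0 + s w *\<^sub>R a1) * \<phi> w * (c0 + t w *\<^sub>R c1) = bil b0 b1 b2 b3 (s w) (t w)"
    and k: "a0 = r0 *\<^sub>R k" "a1 = r1 *\<^sub>R k"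
  shows "classified (\<phi> ` D)"
proof (rule right_quotient_classified [OF grid], intro ballI)
  fix w assume w: "w \<in> D"
  let ?r = "r0 + s w * r1" and ?C = "c0 + t w *\<^sub>R c1"
  have A: "a0 + s w *\<^sub>R a1 = ?r *\<^sub>R k" by (simp add: k algebra_simps)
  have C: "bil (r0 *\<^sub>R c0) (r1 *\<^sub>R c0) (r0 *\<^sub>R c1) (r1 *\<^sub>R c1) (s w) (t w) = ?r *\<^sub>R ?C"
    by (simp add: bil_def algebra_simps)
  have nz': "?r \<noteq> 0" "k \<noteq> 0" "?C \<noteq> 0" using nz [rule_format, OF w] unfolding A by auto
  have "bil (inverse k * b0) (inverse k * b1) (inverse k * b2) (inverse k * b3) (s w) (t w)
    = inverse k * (?r *\<^sub>R k * \<phi> w * ?C)"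
    using eq [rule_format, OF w] unfolding A bil_mult [symmetric] by simp
  also have "\<dots> = (inverse k * k) * (\<phi> w * (?r *\<^sub>R ?C))"
    by (simp only: mult_scaleR_left mult_scaleR_right mult.assoc)
  also have "\<dots> = \<phi> w * (?r *\<^sub>R ?C)" using nz'(2) by simp
  finally show "bil (r0 *\<^sub>R c0) (r1 *\<^sub>R c0) (r0 *\<^sub>R c1) (r1 *\<^sub>R c1) (s w) (t w) \<noteq> 0 \<and>
      bil (inverse k * b0) (inverse k * b1) (inverse k * b2) (inverse k * b3) (s w) (t w) =
      \<phi> w * bil (r0 *\<^sub>R c0) (r1 *\<^sub>R c0) (r0 *\<^sub>R c1) (r1 *\<^sub>R c1) (s w) (t w)"
    unfolding C using nz' by simp
qed

lemma real_multiple_right_classified: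
  assumes grid: "param_grid s t D"
    and nz: "\<forall>w\<in>D. a0 + s w *\<^sub>R a1 \<noteq> 0 \<and> c0 + t w *\<^sub>R c1 \<noteq> 0"
    and eq: "\<forall>w\<in>D. (a0 + s w *\<^sub>R a1) * \<phi> w * (c0 + t w *\<^sub>R c1) = bil b0 b1 b2 b3 (s w) (t w)"
    and k: "c0 = r0 *\<^sub>R k" "c1 = r1 *\<^sub>R k"
  shows "classified (\<phi> ` D)"
proof (rule left_quotient_classified [OF grid], intro ballI)
  fix w assume w: "w \<in> D"
  let ?r = "r0 + t w * r1" and ?A = "a0 + s w *\<^sub>R a1"
  have C: "c0 + t w *\<^sub>R c1 = ?r *\<^sub>R k" by (simp add: k algebra_simps)
  have A: "bil (r0 *\<^sub>R a0) (r0 *\<^sub>R a1) (r1 *\<^sub>R a0) (r1 *\<^sub>R a1) (s w) (t w) = ?r *\<^sub>R ?A"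
    by (simp add: bil_def algebra_simps)
  have nz': "?r \<noteq> 0" "k \<noteq> 0" "?A \<noteq> 0" using nz [rule_format, OF w] unfolding C by auto
  have "bil (b0 * inverse k) (b1 * inverse k) (b2 * inverse k) (b3 * inverse k) (s w) (t w)
    = (?A * \<phi> w * (?r *\<^sub>R k)) * inverse k"
    using eq [rule_format, OF w] unfolding C bil_mult [symmetric] by simp
  also have "\<dots> = (?r *\<^sub>R ?A * \<phi> w) * (k * inverse k)"
    by (simp only: mult_scaleR_left mult_scaleR_right mult.assoc)
  also have "\<dots> = ?r *\<^sub>R ?A * \<phi> w" using nz'(2) by simp
  finally show "bil (r0 *\<^sub>R a0) (r0 *\<^sub>R a1) (r1 *\<^sub>R a0) (r1 *\<^sub>R a1) (s w) (t w) \<noteq> 0 \<and>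
      bil (b0 * inverse k) (b1 * inverse k) (b2 * inverse k) (b3 * inverse k) (s w) (t w) =
      bil (r0 *\<^sub>R a0) (r0 *\<^sub>R a1) (r1 *\<^sub>R a0) (r1 *\<^sub>R a1) (s w) (t w) * \<phi> w"
    unfolding A using nz' by simp
qed

text \<open>The denominators are written as \<open>a1 * (s + a)\<close> and
  \<open>(t + c) * c1\<close>. When a leading coefficient is 0, or \<open>a\<close> or
  \<open>c\<close> is real, one denominator is a real polynomial times a constant. Otherwise the
  real parts of \<open>a\<close> and \<open>c\<close> are absorbed by shifting the
  parameters.\<close>

lemma split_denominators_classified:
  assumes grid: "param_grid s t D"
    and nz: "\<forall>w\<in>D. a0 + s w *\<^sub>R a1 \<noteq> 0 \<and> c0 + t w *\<^sub>R c1 \<noteq> 0"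
    and eq: "\<forall>w\<in>D. (a0 + s w *\<^sub>R a1) * \<phi> w * (c0 + t w *\<^sub>R c1) = bil b0 b1 b2 b3 (s w) (t w)"
  shows "classified (\<phi> ` D)"
proof -
  define a where "a = inverse a1 * a0"
  define c where "c = c0 * inverse c1"
  define a' where "a' = a - of_real (qRe a)"
  define c' where "c' = c - of_real (qRe c)"
  consider "a1 = 0" | "c1 = 0" | "a1 \<noteq> 0" "a' = 0" | "c1 \<noteq> 0" "c' = 0" |
    "a1 \<noteq> 0" "c1 \<noteq> 0" "a' \<noteq> 0" "c' \<noteq> 0" by blast
  then show ?thesis
  proof cases
    case 1
    then show ?thesis
      by (intro real_multiple_left_classified [OF grid nz eq, of 1 a0 0]) simp_all
  next
    case 2
    then show ?thesis
      by (intro real_multiple_right_classified [OF grid nz eq, of 1 c0 0]) simp_all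
  next
    case 3
    then have "a0 = a1 * of_real (qRe a)" by (metis a'_def a_def eq_iff_diff_eq_0 mult.assoc mult_1_left right_inverse)
    then have "a0 = qRe a *\<^sub>R a1" by (simp add: of_real_def)
    then show ?thesis
      by (intro real_multiple_left_classified [OF grid nz eq, of "qRe a" a1 1]) simp_all
  next
    case 4
    then have "c0 = of_real (qRe c) * c1" by (metis c'_def c_def eq_iff_diff_eq_0 mult.assoc mult_1_right left_inverse)
    then have "c0 = qRe c *\<^sub>R c1" by (simp add: of_real_def)
    then show ?thesis
      by (intro real_multiple_right_classified [OF grid nz eq, of "qRe c" c1 1]) simp_all
  next
    case 5
    have "(of_real (s w + qRe a) + a') * \<phi> w * (of_real (t w + qRe c) + c')
      = bil (inverse a1 * b0 * inverse c1) (inverse a1 * b1 * inverse c1)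
          (inverse a1 * b2 * inverse c1) (inverse a1 * b3 * inverse c1) (s w) (t w)" if w: "w \<in> D" for w
    proof -
      have A: "of_real (s w + qRe a) + a' = inverse a1 * (a0 + s w *\<^sub>R a1)"
        using 5 by (simp add: a'_def a_def distrib_left of_real_def [of "s w"] del: quat_times_sel)
      have C: "of_real (t w + qRe c) + c' = (c0 + t w *\<^sub>R c1) * inverse c1"
        using 5 by (simp add: c'_def c_def distrib_right of_real_def [of "t w"] del: quat_times_sel)
      have "(of_real (s w + qRe a) + a') * \<phi> w * (of_real (t w + qRe c) + c')
        = inverse a1 * ((a0 + s w *\<^sub>R a1) * \<phi> w * (c0 + t w *\<^sub>R c1)) * inverse c1"
        unfolding A C by (simp only: mult.assoc)
      then show ?thesis
        unfolding eq [rule_format, OF w] bil_mult .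
    qed
    from trans [OF this bil_shift [where x = "qRe a" and y = "qRe c"]]
    have "\<exists>b0 b1 b2 b3. \<forall>w\<in>D. (of_real (s w + qRe a) + a') * \<phi> w * (of_real (t w + qRe c) + c')
      = bil b0 b1 b2 b3 (s w + qRe a) (t w + qRe c)" by blast
    moreover have "qRe a' = 0" "qRe c' = 0" by (simp_all add: a'_def c'_def)
    ultimately show ?thesis
      using 5(3,4) middle_classified [OF param_grid_shift [OF grid]] by blast
  qed
qed

section \<open>Coefficients in the polynomial ring and the degree condition on the product\<close>

lemma keys_Hpoly_1_1:
  assumes "P \<in> Hpoly 1 1"
  shows "Poly_Mapping.keys P \<subseteq> {(0, 0), (1, 0), (0, 1), (1, 1)}"
proof
  fix k assume k: "k \<in> Poly_Mapping.keys P"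
  obtain i j where ij: "k = (i, j)" by (cases k)
  then have "i \<le> 1" "j \<le> 1" using assms k unfolding Hpoly_def by auto
  then have "i = 0 \<or> i = 1" "j = 0 \<or> j = 1" by linarith+
  then show "k \<in> {(0, 0), (1, 0), (0, 1), (1, 1)}" using ij by blast
qed

lemma eval_qp_Hpoly_1_1:
  assumes "P \<in> Hpoly 1 1"
  shows "eval_qp P (u, v) = bil (Poly_Mapping.lookup P (0, 0)) (Poly_Mapping.lookup P (1, 0))
    (Poly_Mapping.lookup P (0, 1)) (Poly_Mapping.lookup P (1, 1)) u v"
proof -
  note sub = keys_Hpoly_1_1 [OF assms]
  have "eval_qp P (u, v) = (\<Sum>(i, j) \<in> {(0, 0), (1, 0), (0, 1), (1, 1)}. (u ^ i * v ^ j) *\<^sub>R Poly_Mapping.lookup P (i, j))"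
    unfolding eval_qp_def prod.case
    by (rule sum.mono_neutral_left) (use sub in \<open>auto simp: in_keys_iff\<close>)
  then show ?thesis by (simp add: bil_def)
qed

lemma Hpoly_1_1_eq_sum_single:
  assumes "P \<in> Hpoly 1 1"
  shows "P = Poly_Mapping.single (0, 0) (Poly_Mapping.lookup P (0, 0))
    + Poly_Mapping.single (1, 0) (Poly_Mapping.lookup P (1, 0))
    + Poly_Mapping.single (0, 1) (Poly_Mapping.lookup P (0, 1))
    + Poly_Mapping.single (1, 1) (Poly_Mapping.lookup P (1, 1))"
proof (rule poly_mapping_eqI)
  fix k :: "nat \<times> nat"
  have "k \<in> {(0, 0), (1, 0), (0, 1), (1, 1)} \<or> Poly_Mapping.lookup P k = 0"
    using keys_Hpoly_1_1 [OF assms] by (meson in_keys_iff subsetD)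
  then show "Poly_Mapping.lookup P k = Poly_Mapping.lookup
    (Poly_Mapping.single (0, 0) (Poly_Mapping.lookup P (0, 0))
    + Poly_Mapping.single (1, 0) (Poly_Mapping.lookup P (1, 0))
    + Poly_Mapping.single (0, 1) (Poly_Mapping.lookup P (0, 1))
    + Poly_Mapping.single (1, 1) (Poly_Mapping.lookup P (1, 1))) k"
    by (auto simp: lookup_add lookup_single when_def)
qed

text \<open>The coefficients of the product at \<open>(2, 0)\<close>, \<open>(2, 1)\<close>,
  \<open>(2, 2)\<close> vanish, and there are no zero divisors, so at most one factor involves u;
  likewise for v.\<close>

lemma product_in_Hpoly_1_1:
  assumes "A \<in> Hpoly 1 1" "C \<in> Hpoly 1 1" "A * C \<in> Hpoly 1 1"
  shows "(Poly_Mapping.lookup A (1, 0) = 0 \<and> Poly_Mapping.lookup A (1, 1) = 0) \<or>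
         (Poly_Mapping.lookup C (1, 0) = 0 \<and> Poly_Mapping.lookup C (1, 1) = 0)"
    and "(Poly_Mapping.lookup A (0, 1) = 0 \<and> Poly_Mapping.lookup A (1, 1) = 0) \<or>
         (Poly_Mapping.lookup C (0, 1) = 0 \<and> Poly_Mapping.lookup C (1, 1) = 0)"
proof -
  define a00 where "a00 = Poly_Mapping.lookup A (0, 0)"
  define a10 where "a10 = Poly_Mapping.lookup A (1, 0)"
  define a01 where "a01 = Poly_Mapping.lookup A (0, 1)"
  define a11 where "a11 = Poly_Mapping.lookup A (1, 1)"
  define c00 where "c00 = Poly_Mapping.lookup C (0, 0)"
  define c10 where "c10 = Poly_Mapping.lookup C (1, 0)"
  define c01 where "c01 = Poly_Mapping.lookup C (0, 1)"
  define c11 where "c11 = Poly_Mapping.lookup C (1, 1)"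
  note defs = a00_def a10_def a01_def a11_def c00_def c10_def c01_def c11_def
  have A: "A = Poly_Mapping.single (0, 0) a00 + Poly_Mapping.single (1, 0) a10
      + Poly_Mapping.single (0, 1) a01 + Poly_Mapping.single (1, 1) a11"
    and C: "C = Poly_Mapping.single (0, 0) c00 + Poly_Mapping.single (1, 0) c10
      + Poly_Mapping.single (0, 1) c01 + Poly_Mapping.single (1, 1) c11"
    using Hpoly_1_1_eq_sum_single [OF assms(1)] Hpoly_1_1_eq_sum_single [OF assms(2)] unfolding defs by auto
  have zero: "Poly_Mapping.lookup (A * C) (i, j) = 0" if "i > 1 \<or> j > 1" for i j
  proof -
    have "(i, j) \<notin> Poly_Mapping.keys (A * C)" using assms(3) that unfolding Hpoly_def by auto
    then show ?thesis by (simp add: in_keys_iff)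
  qed
  have "a11 * c11 = 0" "a10 * c10 = 0" "a01 * c01 = 0" "a11 * c10 + a10 * c11 = 0" "a11 * c01 + a01 * c11 = 0"
    using zero [of 2 2] zero [of 2 0] zero [of 0 2] zero [of 2 1] zero [of 1 2]
    unfolding A C by (simp_all add: distrib_left distrib_right mult_single lookup_add lookup_single when_def)
  then show "(Poly_Mapping.lookup A (1, 0) = 0 \<and> Poly_Mapping.lookup A (1, 1) = 0) \<or>
         (Poly_Mapping.lookup C (1, 0) = 0 \<and> Poly_Mapping.lookup C (1, 1) = 0)"
    "(Poly_Mapping.lookup A (0, 1) = 0 \<and> Poly_Mapping.lookup A (1, 1) = 0) \<or>
         (Poly_Mapping.lookup C (0, 1) = 0 \<and> Poly_Mapping.lookup C (1, 1) = 0)"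
    unfolding defs [symmetric] by auto
qed

theorem theorem1p3:
  fixes A B C :: quat_poly and D :: "(real \<times> real) set"
  assumes "A \<in> Hpoly 1 1" and "B \<in> Hpoly 1 1" and "C \<in> Hpoly 1 1"
    and "A * C \<in> Hpoly 1 1"
    and "\<And>w. w \<in> D \<Longrightarrow> eval_qp A w \<noteq> 0 \<and> eval_qp C w \<noteq> 0"
    and "analytic_surface D (Phi A B C)"
  shows "(Phi A B C ` D \<subseteq> ImH \<longrightarrow>
            (\<exists>S. (euclidean_translational S \<or> darboux_cyclide S) \<and> Phi A B C ` D \<subseteq> S)) \<and>
         (Phi A B C ` D \<subseteq> S3 \<longrightarrow>
            (\<exists>S. clifford_translational S \<and> Phi A B C ` D \<subseteq> S) \<or>
            (\<exists>X. other_quadric X \<and> Phi A B C ` D \<subseteq> S3 \<inter> X))"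
proof -
  let ?l = "Poly_Mapping.lookup"
  let ?a = "?l A" and ?b = "?l B" and ?c = "?l C"
  have "open D" "D \<noteq> {}" using assms(6) by (auto simp: analytic_surface_def)
  then have grid: "param_grid fst snd D" "param_grid snd fst D" by (auto intro: open_imp_param_grid)
  have ev: "eval_qp P w = bil (?l P (0, 0)) (?l P (1, 0)) (?l P (0, 1)) (?l P (1, 1)) (fst w) (snd w)"
    if "P \<in> Hpoly 1 1" for P w
    using eval_qp_Hpoly_1_1 [OF that, of "fst w" "snd w"] by simp
  have nz: "\<forall>w\<in>D. eval_qp A w \<noteq> 0 \<and> eval_qp C w \<noteq> 0" using assms(5) by blast
  have eq: "\<forall>w\<in>D. eval_qp A w * Phi A B C w * eval_qp C w = eval_qp B w"
  proof
    fix w assume "w \<in> D"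
    then have nzw: "eval_qp A w \<noteq> 0" "eval_qp C w \<noteq> 0" using nz by auto
    have "eval_qp A w * Phi A B C w * eval_qp C w
      = (eval_qp A w * inverse (eval_qp A w)) * eval_qp B w * (inverse (eval_qp C w) * eval_qp C w)"
      unfolding Phi_def by (simp only: mult.assoc)
    then show "eval_qp A w * Phi A B C w * eval_qp C w = eval_qp B w" using nzw by simp
  qed
  note nz' = nz [unfolded ev [OF assms(1)] ev [OF assms(3)]]
  note eq' = eq [unfolded ev [OF assms(1)] ev [OF assms(2)] ev [OF assms(3)]]
  \<comment> \<open>In each variable one of the two denominators has degree 0, which gives four
    combinations.\<close>
  consider
    "?a (1, 0) = 0" "?a (0, 1) = 0" "?a (1, 1) = 0" |
    "?c (1, 0) = 0" "?c (0, 1) = 0" "?c (1, 1) = 0" |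
    "?a (1, 0) = 0" "?a (1, 1) = 0" "?c (0, 1) = 0" "?c (1, 1) = 0" |
    "?a (0, 1) = 0" "?a (1, 1) = 0" "?c (1, 0) = 0" "?c (1, 1) = 0"
    using product_in_Hpoly_1_1 [OF assms(1,3,4)] by blast
  then have "classified (Phi A B C ` D)"
  proof cases
    case 1
    have k: "?a (0, 0) \<noteq> 0" using nz' \<open>D \<noteq> {}\<close> unfolding 1 by (auto simp: bil_def)
    show ?thesis
    proof (rule right_quotient_classified [OF grid(1)], intro ballI conjI)
      fix w assume w: "w \<in> D"
      show "bil (?c (0, 0)) (?c (1, 0)) (?c (0, 1)) (?c (1, 1)) (fst w) (snd w) \<noteq> 0"
        using nz' w by blast
      have *: "?a (0, 0) * (Phi A B C w * bil (?c (0, 0)) (?c (1, 0)) (?c (0, 1)) (?c (1, 1)) (fst w) (snd w))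
        = bil (?b (0, 0)) (?b (1, 0)) (?b (0, 1)) (?b (1, 1)) (fst w) (snd w)"
        using eq' w unfolding 1 bil_def [of _ 0 0 0] by (simp add: mult.assoc)
      show "bil (inverse (?a (0, 0)) * ?b (0, 0)) (inverse (?a (0, 0)) * ?b (1, 0))
          (inverse (?a (0, 0)) * ?b (0, 1)) (inverse (?a (0, 0)) * ?b (1, 1)) (fst w) (snd w)
        = Phi A B C w * bil (?c (0, 0)) (?c (1, 0)) (?c (0, 1)) (?c (1, 1)) (fst w) (snd w)"
        unfolding bil_mult(1) [symmetric] * [symmetric] by (rule quat_inverse_cancel(1) [OF k])
    qed
  next
    case 2
    have k: "?c (0, 0) \<noteq> 0" using nz' \<open>D \<noteq> {}\<close> unfolding 2 by (auto simp: bil_def)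
    show ?thesis
    proof (rule left_quotient_classified [OF grid(1)], intro ballI conjI)
      fix w assume w: "w \<in> D"
      show "bil (?a (0, 0)) (?a (1, 0)) (?a (0, 1)) (?a (1, 1)) (fst w) (snd w) \<noteq> 0"
        using nz' w by blast
      have *: "bil (?a (0, 0)) (?a (1, 0)) (?a (0, 1)) (?a (1, 1)) (fst w) (snd w) * Phi A B C w * ?c (0, 0)
        = bil (?b (0, 0)) (?b (1, 0)) (?b (0, 1)) (?b (1, 1)) (fst w) (snd w)"
        using eq' w unfolding 2 bil_def [of _ 0 0 0] by simp
      show "bil (?b (0, 0) * inverse (?c (0, 0))) (?b (1, 0) * inverse (?c (0, 0)))
          (?b (0, 1) * inverse (?c (0, 0))) (?b (1, 1) * inverse (?c (0, 0))) (fst w) (snd w)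
        = bil (?a (0, 0)) (?a (1, 0)) (?a (0, 1)) (?a (1, 1)) (fst w) (snd w) * Phi A B C w"
        unfolding bil_mult(2) [symmetric] * [symmetric] by (rule quat_inverse_cancel(2) [OF k])
    qed
  next
    case 3
    \<comment> \<open>\<open>A\<close> depends on v only and \<open>C\<close> on u only, so
      \<open>snd\<close> becomes the first parameter and the two linear coefficients of
      \<open>B\<close> change places.\<close>
    have A: "bil (?a (0, 0)) (?a (1, 0)) (?a (0, 1)) (?a (1, 1)) u v = ?a (0, 0) + v *\<^sub>R ?a (0, 1)"
      and C: "bil (?c (0, 0)) (?c (1, 0)) (?c (0, 1)) (?c (1, 1)) u v = ?c (0, 0) + u *\<^sub>R ?c (1, 0)"
      and B: "bil (?b (0, 0)) (?b (1, 0)) (?b (0, 1)) (?b (1, 1)) u v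
        = bil (?b (0, 0)) (?b (0, 1)) (?b (1, 0)) (?b (1, 1)) v u" for u v
      unfolding 3 by (simp_all add: bil_def algebra_simps)
    show ?thesis
      by (rule split_denominators_classified [OF grid(2) nz' [unfolded A C] eq' [unfolded A B C]])
  next
    case 4
    have A: "bil (?a (0, 0)) (?a (1, 0)) (?a (0, 1)) (?a (1, 1)) u v = ?a (0, 0) + u *\<^sub>R ?a (1, 0)"
      and C: "bil (?c (0, 0)) (?c (1, 0)) (?c (0, 1)) (?c (1, 1)) u v = ?c (0, 0) + v *\<^sub>R ?c (0, 1)" for u v
      unfolding 4 by (simp_all add: bil_def)
    show ?thesis
      by (rule split_denominators_classified [OF grid(1) nz' [unfolded A C] eq' [unfolded A C]])
  qed
  then show ?thesis unfolding classified_def .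
qed

end
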